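(* The class AsLimAvg is incomparable in expressive power with the class PosLimAvg and with the class NLimAvg (i.e., AsLimAvg is not reducible to PosLimAvg, PosLimAvg is not reducible to AsLimAvg, AsLimAvg is not reducible to NLimAvg, and NLimAvg is not reducible to AsLimAvg), and NLimAvg cannot express all languages expressible by PosLimAvg (i.e., PosLimAvg is not reducible to NLimAvg).
   Context: A probabilistic weighted automaton over a finite alphabet $\Sigma$ is a tuple $A=(Q,\rho_I,\Sigma,\delta,\gamma)$ where $Q$ is a finite set of states, $\rho_I$ is a probability distribution on $Q$, $\delta:Q\times\Sigma\to\mathcal D(Q)$ assigns to each state and letter a probability distribution on $Q$, and $\gamma:Q\times\Sigma\times Q\to\mathbb Q$ is a weight function. A run over an infinite word $w=\sigma_1\sigma_2\dots$ is a sequence $r=q_0\sigma_1q_1\sigma_2\dots$ with $\rho_I(q_0)>0$ and $\delta(q_i,\sigma_{i+1})(q_{i+1})>0$ for all $i$; its weight sequence is $\gamma(r)=v_0v_1\dots$ with $v_i=\gamma(q_i,\sigma_{i+1},q_{i+1})$. For each $w$, the probabilities $\rho_I(q_0)\prod_{i=1}^k\delta(q_{i-1},\sigma_i)(q_i)$ of finite run prefixes induce a probability measure $\mathbb P^A$ on runs over $w$. For a value function $\mathrm{Val}$, the positive semantics is $L^{>0}_A(w)=\sup\{\eta\mid \mathbb P^A(\{r:\mathrm{Val}(\gamma(r))\ge\eta\})>0\}$ and the almost-sure semantics is $L^{=1}_A(w)=\sup\{\eta\mid \mathbb P^A(\{r:\mathrm{Val}(\gamma(r))\ge\eta\})=1\}$.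 Ignoring probabilities (initial states are those with $\rho_I(q)>0$, transitions those with $\delta(q,\sigma)(q')>0$) gives a nondeterministic automaton with language $L^{\max}_A(w)=\sup\{\mathrm{Val}(\gamma(r))\mid r \text{ run over } w\}$. Here $\mathsf{LimAvg}(v)=\liminf_{n\to\infty}\frac1n\sum_{i=0}^{n-1}v_i$. PosLimAvg, AsLimAvg, NLimAvg denote the classes of $\mathsf{LimAvg}$-automata under positive, almost-sure, and nondeterministic semantics respectively. A class $\mathcal C$ is reducible to $\mathcal C'$ if for every $A\in\mathcal C$ there is $A'\in\mathcal C'$ over the same alphabet defining the same quantitative language $\Sigma^\omega\to\mathbb R$. *)

theory Defs
  imports "HOL-Probability.Probability"
begin

text \<open>Probabilistic weighted automata. States are natural numbers (a finite
carrier set of states), letters are natural numbers (a finite carrier set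
of letters, the alphabet). An infinite word is a function w :: nat => nat,
where w i is the (i+1)-th letter. A run is a state sequence r :: nat => nat,
where r i is the state q_i.\<close>

record pwa =
  pa_states :: "nat set"
  pa_init   :: "nat \<Rightarrow> real"
  pa_trans  :: "nat \<Rightarrow> nat \<Rightarrow> nat \<Rightarrow> real"
  pa_wt     :: "nat \<Rightarrow> nat \<Rightarrow> nat \<Rightarrow> real"

definition wf_pwa :: "nat set \<Rightarrow> pwa \<Rightarrow> bool" where
  "wf_pwa \<Sigma> A \<longleftrightarrow>
     finite (pa_states A) \<and>
     (\<forall>q. pa_init A q \<ge> 0) \<and> (\<forall>q. q \<notin> pa_states A \<longrightarrow> pa_init A q = 0) \<and>
     (\<Sum>q\<in>pa_states A. pa_init A q) = 1 \<and>
     (\<forall>q\<in>pa_states A. \<forall>\<sigma>\<in>\<Sigma>.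
        (\<forall>q'. pa_trans A q \<sigma> q' \<ge> 0) \<and>
        (\<forall>q'. q' \<notin> pa_states A \<longrightarrow> pa_trans A q \<sigma> q' = 0) \<and>
        (\<Sum>q'\<in>pa_states A. pa_trans A q \<sigma> q') = 1) \<and>
     (\<forall>q\<in>pa_states A. \<forall>\<sigma>\<in>\<Sigma>. \<forall>q'\<in>pa_states A. pa_wt A q \<sigma> q' \<in> \<rat>)"

definition is_word :: "nat set \<Rightarrow> (nat \<Rightarrow> nat) \<Rightarrow> bool" where
  "is_word \<Sigma> w \<longleftrightarrow> (\<forall>i. w i \<in> \<Sigma>)"

definition is_run :: "pwa \<Rightarrow> (nat \<Rightarrow> nat) \<Rightarrow> (nat \<Rightarrow> nat) \<Rightarrow> bool" where
  "is_run A w r \<longleftrightarrow> pa_init A (r 0) > 0 \<and> (\<forall>i. pa_trans A (r i) (w i) (r (Suc i)) > 0)"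

definition run_weights :: "pwa \<Rightarrow> (nat \<Rightarrow> nat) \<Rightarrow> (nat \<Rightarrow> nat) \<Rightarrow> nat \<Rightarrow> real" where
  "run_weights A w r i = pa_wt A (r i) (w i) (r (Suc i))"

definition LimAvg :: "(nat \<Rightarrow> real) \<Rightarrow> real" where
  "LimAvg v = real_of_ereal (liminf (\<lambda>n. ereal ((\<Sum>i<n. v i) / real n)))"

definition seq_space :: "(nat \<Rightarrow> nat) measure" where
  "seq_space = PiM UNIV (\<lambda>_. count_space UNIV)"

text \<open>The probability measure on state sequences induced by the probabilities
of finite run prefixes (the unique such measure, by Caratheodory).\<close>
definition run_measure :: "pwa \<Rightarrow> (nat \<Rightarrow> nat) \<Rightarrow> (nat \<Rightarrow> nat) measure" where
  "run_measure A w = (SOME M. prob_space M \<and> sets M = sets seq_space \<and>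
     (\<forall>k qs. emeasure M {r \<in> space seq_space. \<forall>i\<le>k. r i = qs i} =
        ennreal (pa_init A (qs 0) * (\<Prod>i<k. pa_trans A (qs i) (w i) (qs (Suc i))))))"

definition runs_ge :: "pwa \<Rightarrow> (nat \<Rightarrow> nat) \<Rightarrow> real \<Rightarrow> (nat \<Rightarrow> nat) set" where
  "runs_ge A w \<eta> = {r \<in> space seq_space. is_run A w r \<and> LimAvg (run_weights A w r) \<ge> \<eta>}"

definition pos_sem :: "pwa \<Rightarrow> (nat \<Rightarrow> nat) \<Rightarrow> real" where
  "pos_sem A w = Sup {\<eta>. measure (run_measure A w) (runs_ge A w \<eta>) > 0}"

definition as_sem :: "pwa \<Rightarrow> (nat \<Rightarrow> nat) \<Rightarrow> real" where
  "as_sem A w = Sup {\<eta>. measure (run_measure A w) (runs_ge A w \<eta>) = 1}"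

definition nd_sem :: "pwa \<Rightarrow> (nat \<Rightarrow> nat) \<Rightarrow> real" where
  "nd_sem A w = Sup {LimAvg (run_weights A w r) | r. is_run A w r}"

definition reducible ::
  "(pwa \<Rightarrow> (nat \<Rightarrow> nat) \<Rightarrow> real) \<Rightarrow> (pwa \<Rightarrow> (nat \<Rightarrow> nat) \<Rightarrow> real) \<Rightarrow> bool" where
  "reducible sem1 sem2 \<longleftrightarrow>
     (\<forall>\<Sigma> A. finite \<Sigma> \<and> wf_pwa \<Sigma> A \<longrightarrow>
        (\<exists>A'. wf_pwa \<Sigma> A' \<and> (\<forall>w. is_word \<Sigma> w \<longrightarrow> sem1 A w = sem2 A' w)))"

end

theory Submission
  imports Defs
begin

text \<open>The languages "infinitely many ones" (almost-sure automaton) and "finitely many ones"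
  (positive and nondeterministic automaton), with values 0 and 1, separate the almost-sure
  semantics from the other two.

  Suppose that infinitely many ones had a positive or nondeterministic automaton. Every word
  with finitely many ones has value 0, so reading zeros for long enough makes the average small
  again (all runs: cycles on zeros have nonpositive weight; positive semantics: with probability
  close to 1). Inserting ones sparsely enough yields a word with infinitely many ones and value
  at most 1/2. Dually, an almost-sure automaton for finitely many ones has large averages on
  long blocks of zeros from every reachable state, with probability close to 1, hence a positive
  value on a word with infinitely many ones.

  Under the nondeterministic semantics the value of every word is approximated by ultimately
  periodic words, obtained by looping between two visits of a state. The survival automaton
  under the positive semantics has value 0 on every ultimately periodic word with infinitely
  many ones, but 1 on the word with ones at the powers of two.\<close>

subsection \<open>Limit averages\<close>

text \<open>The refutations face an arbitrary automaton, so the contradicting word is built against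
  it. For \<open>nd_sem\<close> there is a bound uniform over all runs, and one periodic word
  suffices. Under the probabilistic semantics the time at which an average becomes good varies from
  run to run; continuity of the measure replaces it by a deterministic time that works in round i
  with probability at least 1 - (1/2)^i. These errors are summable, so by Borel-Cantelli almost
  every run succeeds in all but finitely many rounds. Two facts make such rounds possible: letters
  read later do not affect events about a prefix (\<open>run_measure_local\<close>), and the future
  after a visit of q is governed by the automaton started at q (\<open>markov_property\<close>). The
  survival automaton separates bounded from fast growing gaps between ones: with period m each
  period costs at least the fraction 2^-m of the surviving mass, whereas for gaps of length about
  2^k the product of the factors 1 - 2^-gap stays positive. A nondeterministic automaton cannot tell
  these apart, since a good run can be looped.\<close>

definition avg :: "(nat \<Rightarrow> real) \<Rightarrow> nat \<Rightarrow> real" where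
  "avg v n = (\<Sum>i<n. v i) / real n"

lemma abs_sum_le_bound:
  fixes v :: "nat \<Rightarrow> real"
  assumes "\<And>i. \<bar>v i\<bar> \<le> W"
  shows "\<bar>\<Sum>i<n. v i\<bar> \<le> W * real n"
proof -
  have "\<bar>\<Sum>i<n. v i\<bar> \<le> (\<Sum>i<n. \<bar>v i\<bar>)" by (rule sum_abs)
  also have "\<dots> \<le> (\<Sum>i<n. W)" by (intro sum_mono assms)
  finally show ?thesis by (simp add: mult.commute)
qed

lemma abs_avg_le_bound:
  assumes "\<And>i. \<bar>v i\<bar> \<le> W"
  shows "\<bar>avg v n\<bar> \<le> W"
proof (cases "n = 0")
  case True
  then show ?thesis using assms[of 0] by (simp add: avg_def)
next
  case False
  then show ?thesis using abs_sum_le_bound[of v W n, OF assms] by (simp add: avg_def field_simps)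
qed

text \<open>\<open>real_of_ereal\<close> sends infinite values to 0, so \<open>LimAvg v\<close> is
  the liminf only once the liminf is known to be finite; a bound on the weights gives this.\<close>

lemma ereal_LimAvg:
  assumes "\<And>i. \<bar>v i\<bar> \<le> W"
  shows "ereal (LimAvg v) = liminf (\<lambda>n. ereal (avg v n))"
proof -
  have 1: "- W \<le> avg v n" "avg v n \<le> W" for n
    using abs_avg_le_bound[of v W n, OF assms] by auto
  have "ereal (- W) \<le> liminf (\<lambda>n. ereal (avg v n))"
    by (intro Liminf_bounded always_eventually) (use 1 in auto)
  moreover have "liminf (\<lambda>n. ereal (avg v n)) \<le> limsup (\<lambda>n. ereal (avg v n))"
    by (intro Liminf_le_Limsup) auto
  moreover have "limsup (\<lambda>n. ereal (avg v n)) \<le> ereal W"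
    by (intro Limsup_bounded always_eventually) (use 1 in auto)
  ultimately have "\<bar>liminf (\<lambda>n. ereal (avg v n))\<bar> \<noteq> \<infinity>" by auto
  then show ?thesis unfolding LimAvg_def avg_def[symmetric] by (simp add: ereal_real)
qed

lemma LimAvg_geI:
  assumes "\<And>i. \<bar>v i\<bar> \<le> W" "\<forall>\<^sub>F n in sequentially. c \<le> avg v n"
  shows "c \<le> LimAvg v"
proof -
  have "ereal c \<le> liminf (\<lambda>n. ereal (avg v n))"
    by (intro Liminf_bounded) (use assms(2) in auto)
  then show ?thesis using ereal_LimAvg[of v W, OF assms(1)] by (metis ereal_less_eq(3))
qed

lemma LimAvg_gtD:
  assumes "\<And>i. \<bar>v i\<bar> \<le> W" "c < LimAvg v"
  shows "\<forall>\<^sub>F n in sequentially. c < avg v n"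
proof -
  have "ereal c < liminf (\<lambda>n. ereal (avg v n))"
    using ereal_LimAvg[of v W, OF assms(1)] assms(2) by (metis less_ereal.simps(1))
  from less_LiminfD[OF this] show ?thesis by simp
qed

lemma LimAvg_le_bound:
  assumes "\<And>i. \<bar>v i\<bar> \<le> W"
  shows "- W \<le> LimAvg v" "LimAvg v \<le> W"
proof -
  have *: "- W \<le> avg v n" "avg v n \<le> W" for n
    using abs_avg_le_bound[of v W n, OF assms] by auto
  show "- W \<le> LimAvg v" by (rule LimAvg_geI[of v W, OF assms]) (use * in auto)
  show "LimAvg v \<le> W"
  proof (rule ccontr)
    assume "\<not> LimAvg v \<le> W"
    then have "\<forall>\<^sub>F n in sequentially. W < avg v n" by (intro LimAvg_gtD[of v W, OF assms]) auto
    then obtain n where "W < avg v n" by (auto simp: eventually_sequentially)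
    with * show False by (simp add: not_less[symmetric])
  qed
qed

text \<open>A constant deficit \<open>K\<close> vanishes after division by \<open>n\<close>. Lower
  bounds for periodic sequences and for block words are proved in this linear form.\<close>

lemma LimAvg_ge_linear:
  assumes v: "\<And>i. \<bar>v i\<bar> \<le> W" and K: "\<And>n. c * real n - K \<le> (\<Sum>i<n. v i)"
  shows "c \<le> LimAvg v"
proof (rule field_le_epsilon)
  fix e :: real assume e: "0 < e"
  have "c - e \<le> LimAvg v"
  proof (rule LimAvg_geI[OF v])
    show "\<forall>\<^sub>F n in sequentially. c - e \<le> avg v n"
      using eventually_gt_at_top[of "nat \<lceil>\<bar>K\<bar> / e\<rceil>"]
    proof eventually_elim
      case (elim n)
      then have "\<bar>K\<bar> / e < real n" by linarith
      moreover have "0 \<le> \<bar>K\<bar> / e" using e by simp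
      ultimately have "real n > 0" by linarith
      have "\<bar>K\<bar> \<le> e * real n" using \<open>\<bar>K\<bar> / e < real n\<close> e by (simp add: field_simps)
      then show ?case using K[of n] \<open>real n > 0\<close> by (simp add: avg_def field_simps)
    qed
  qed
  then show "c \<le> LimAvg v + e" by simp
qed

lemma LimAvg_le_frequently:
  assumes v: "\<And>i. \<bar>v i\<bar> \<le> W" and f: "\<And>N. \<exists>n\<ge>N. avg v n \<le> c"
  shows "LimAvg v \<le> c"
proof (rule ccontr)
  assume "\<not> LimAvg v \<le> c"
  then have "\<forall>\<^sub>F n in sequentially. c < avg v n" by (intro LimAvg_gtD[OF v]) auto
  then obtain N where "\<And>n. n \<ge> N \<Longrightarrow> c < avg v n" by (auto simp: eventually_sequentially)
  with f[of N] show False by force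
qed

lemma LimAvg_eventually_const:
  assumes "\<And>i. i \<ge> N \<Longrightarrow> v i = c"
  shows "LimAvg v = c"
proof -
  define S where "S = (\<Sum>i<N. v i) - c * real N"
  have eq: "avg v n = c + S / real n" if "n \<ge> N" "n > 0" for n
  proof -
    have "(\<Sum>i<n. v i) = (\<Sum>i<N. v i) + (\<Sum>i\<in>{N..<n}. v i)"
      using that by (metis lessThan_atLeast0 sum.atLeastLessThan_concat zero_le)
    also have "(\<Sum>i\<in>{N..<n}. v i) = (\<Sum>i\<in>{N..<n}. c)" using assms by (intro sum.cong) auto
    finally show ?thesis using that by (simp add: avg_def S_def field_simps of_nat_diff)
  qed
  have "(\<lambda>n. c + S / real n) \<longlonglongrightarrow> c + 0"
    by (intro tendsto_add tendsto_const lim_const_over_n)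
  then have "(\<lambda>n. c + S / real n) \<longlonglongrightarrow> c" by simp
  then have "avg v \<longlonglongrightarrow> c"
    by (rule Lim_transform_eventually)
      (use eventually_ge_at_top[of "max N 1"] in \<open>auto elim!: eventually_mono simp: eq\<close>)
  then have "(\<lambda>n. ereal (avg v n)) \<longlonglongrightarrow> ereal c" by simp
  then have "liminf (\<lambda>n. ereal (avg v n)) = ereal c" by (intro lim_imp_Liminf) auto
  then show ?thesis by (simp add: LimAvg_def avg_def)
qed

lemma sum_lessThan_add:
  fixes v :: "nat \<Rightarrow> real"
  shows "(\<Sum>i<n + m. v i) = (\<Sum>i<n. v i) + (\<Sum>i<m. v (n + i))"
  by (induction m) (auto simp: algebra_simps)

lemma LimAvg_periodic_ge:
  assumes v: "\<And>i. \<bar>v i\<bar> \<le> W" and m: "m > 0"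
    and per: "\<And>i. i \<ge> s \<Longrightarrow> v (i + m) = v i"
    and B: "c * real m \<le> (\<Sum>i<m. v (s + i))"
  shows "c \<le> LimAvg v"
proof (rule LimAvg_ge_linear[OF v])
  \<comment> \<open>The deficit has two sources: the prefix of length \<open>s\<close> and the
    unfinished last period, shorter than \<open>m\<close>.\<close>
  define K where "K = (W + \<bar>c\<bar>) * (real s + real m)"
  have W: "W \<ge> 0" using v[of 0] by linarith
  have per': "v (s + j * m + i) = v (s + i)" for i j
  proof (induction j)
    case (Suc j)
    have "s + Suc j * m + i = (s + j * m + i) + m" by simp
    then show ?case using Suc per[of "s + j * m + i"] by (metis add.assoc le_add1)
  qed simp
  have S: "(\<Sum>i<s + j * m. v i) = (\<Sum>i<s. v i) + real j * (\<Sum>i<m. v (s + i))" for j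
  proof (induction j)
    case (Suc j)
    have "s + Suc j * m = (s + j * m) + m" by simp
    then have "(\<Sum>i<s + Suc j * m. v i) = (\<Sum>i<s + j * m. v i) + (\<Sum>i<m. v (s + i))"
      by (simp only: sum_lessThan_add per')
    then show ?case using Suc by (simp add: algebra_simps)
  qed simp
  fix n
  show "c * real n - K \<le> (\<Sum>i<n. v i)"
  proof (cases "n < s")
    case True
    have "- (W * real n) \<le> (\<Sum>i<n. v i)" using abs_sum_le_bound[of v W n, OF v] by linarith
    moreover have "c * real n \<le> \<bar>c\<bar> * real n" by (intro mult_right_mono) auto
    moreover have "(W + \<bar>c\<bar>) * real n \<le> K"
      unfolding K_def using True W by (intro mult_left_mono) auto
    ultimately show ?thesis by (simp add: algebra_simps)
  next
    case False
    define j where "j = (n - s) div m"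
    define l where "l = (n - s) mod m"
    have n: "n = (s + j * m) + l" using False by (simp add: j_def l_def)
    have l: "l < m" using m by (simp add: l_def)
    have "(\<Sum>i<n. v i) = (\<Sum>i<s. v i) + real j * (\<Sum>i<m. v (s + i)) + (\<Sum>i<l. v (s + j * m + i))"
      unfolding n sum_lessThan_add[of v "s + j * m"] S by simp
    moreover have "- (W * real s) \<le> (\<Sum>i<s. v i)" using abs_sum_le_bound[of v W s, OF v] by linarith
    moreover have "- (W * real l) \<le> (\<Sum>i<l. v (s + j * m + i))"
      using abs_sum_le_bound[of "\<lambda>i. v (s + j * m + i)" W l, OF v] by linarith
    moreover have "real j * (c * real m) \<le> real j * (\<Sum>i<m. v (s + i))"
      using B by (intro mult_left_mono) auto
    moreover have "W * real l \<le> W * real m" using l W by (intro mult_left_mono) auto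
    moreover have "c * (real s + real l) \<le> \<bar>c\<bar> * (real s + real m)"
      using l by (intro mult_mono) auto
    moreover have "c * real n = c * (real s + real l) + real j * (c * real m)"
      unfolding n by (simp add: algebra_simps)
    ultimately show ?thesis unfolding K_def by (simp add: algebra_simps)
  qed
qed

subsection \<open>The run measure and its Markov property\<close>

lemma space_seq_space [simp]: "space seq_space = UNIV"
  by (simp add: seq_space_def space_PiM)

lemma UNIV_in_seq_space [simp]: "UNIV \<in> sets seq_space"
  using sets.top[of seq_space] by simp

lemma measurable_coordinate [measurable]: "(\<lambda>r. r i) \<in> measurable seq_space (count_space UNIV)"
  unfolding seq_space_def by measurable

lemma cylinder_sets [simp]:
  "{r. \<forall>i\<le>k. r i = qs i} \<in> sets seq_space"
  "{r. \<forall>i\<le>k. r (t + i) = qs i} \<in> sets seq_space"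
proof -
  have "{r \<in> space seq_space. \<forall>i\<le>k. r i = qs i} \<in> sets seq_space"
    "{r \<in> space seq_space. \<forall>i\<le>k. r (t + i) = qs i} \<in> sets seq_space"
    by measurable
  then show "{r. \<forall>i\<le>k. r i = qs i} \<in> sets seq_space"
    "{r. \<forall>i\<le>k. r (t + i) = qs i} \<in> sets seq_space" by simp_all
qed

text \<open>Lists of naturals form a countable type, so an event about the first coordinates is a
  countable disjoint union of fibres of this map.\<close>

definition prefix_upto :: "nat \<Rightarrow> (nat \<Rightarrow> nat) \<Rightarrow> nat list" where
  "prefix_upto k r = map r [0..<Suc k]"

lemma prefix_upto_eq_iff: "prefix_upto k r = prefix_upto k r' \<longleftrightarrow> (\<forall>i\<le>k. r i = r' i)"
  unfolding prefix_upto_def by (auto simp: less_Suc_eq_le)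

lemma prefix_upto_eq_iff_nth:
  "prefix_upto k r = p \<longleftrightarrow> length p = Suc k \<and> (\<forall>i\<le>k. r i = p ! i)"
proof -
  have "prefix_upto k r = p \<longleftrightarrow> length p = Suc k \<and> (\<forall>i<Suc k. r i = p ! i)"
    unfolding prefix_upto_def list_eq_iff_nth_eq by (auto simp del: upt_Suc)
  then show ?thesis by (simp add: less_Suc_eq_le)
qed

lemma prefix_upto_vimage:
  "prefix_upto k -` {p} = (if length p = Suc k then {r. \<forall>i\<le>k. r i = p ! i} else {})"
  unfolding vimage_def singleton_iff prefix_upto_eq_iff_nth by auto

lemma measurable_prefix_upto [measurable]:
  "prefix_upto k \<in> measurable seq_space (count_space UNIV)"
proof (subst measurable_count_space_eq2_countable, safe)
  fix p :: "nat list"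
  have "prefix_upto k -` {p} \<inter> space seq_space =
      (if length p = Suc k then {r \<in> space seq_space. \<forall>i\<le>k. r i = p ! i} else {})"
    by (simp add: prefix_upto_vimage)
  also have "\<dots> \<in> sets seq_space" by simp
  finally show "prefix_upto k -` {p} \<inter> space seq_space \<in> sets seq_space" .
qed auto

lemma prefix_set_measurable:
  "prefix_upto k -` B \<in> sets seq_space"
  using measurable_sets[OF measurable_prefix_upto[of k], of B] by simp

lemma emeasure_prefix_decompose:
  assumes [simp]: "sets M = sets seq_space" and Y: "Y \<in> sets seq_space"
  shows "emeasure M (prefix_upto k -` B \<inter> Y) =
    (\<integral>\<^sup>+p. emeasure M (prefix_upto k -` {p} \<inter> Y) \<partial>count_space B)"
proof -
  have "prefix_upto k -` B \<inter> Y = (\<Union>p\<in>B. prefix_upto k -` {p} \<inter> Y)" by auto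
  also have "emeasure M \<dots> = (\<integral>\<^sup>+p. emeasure M (prefix_upto k -` {p} \<inter> Y) \<partial>count_space B)"
    by (rule emeasure_UN_countable)
      (auto simp: disjoint_family_on_def intro!: sets.Int Y prefix_set_measurable)
  finally show ?thesis .
qed

text \<open>A generating box constrains finitely many coordinates, hence is a union of fibres of
  \<open>prefix_upto k\<close> for their maximum \<open>k\<close>; countable additivity reduces it
  to cylinders.\<close>

lemma finite_measure_eqI_cylinders:
  assumes M: "sets M = sets seq_space" "finite_measure M" and N: "sets N = sets seq_space"
    and eq: "\<And>k qs. emeasure M {r. \<forall>i\<le>k. r i = qs i} = emeasure N {r. \<forall>i\<le>k. r i = qs i}"
  shows "M = N"
proof (rule measure_eqI_PiM_infinite[OF M(1)[unfolded seq_space_def] N[unfolded seq_space_def] _ M(2)])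
  fix A and J :: "nat set"
  assume J: "finite J"
  define k where "k = Max (insert 0 J)"
  have k: "i \<le> k" if "i \<in> J" for i using that J by (simp add: k_def)
  have single: "emeasure M (prefix_upto k -` {p}) = emeasure N (prefix_upto k -` {p})" for p
  proof (cases "length p = Suc k")
    case True
    then have "prefix_upto k -` {p} = {r. \<forall>i\<le>k. r i = p ! i}" by (simp add: prefix_upto_vimage)
    with eq show ?thesis by simp
  next
    case False
    then have "prefix_upto k -` {p} = {}" by (simp add: prefix_upto_vimage)
    then show ?thesis by simp
  qed
  let ?E = "prod_emb UNIV (\<lambda>_. count_space UNIV) J (Pi\<^sub>E J A) :: (nat \<Rightarrow> nat) set"
  have E: "?E = {r. \<forall>i\<in>J. r i \<in> A i}" by (auto simp: prod_emb_def PiE_iff)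
  have E': "?E = prefix_upto k -` (prefix_upto k ` ?E)"
    unfolding E by (auto simp: prefix_upto_eq_iff k)
  show "emeasure M ?E = emeasure N ?E"
    using emeasure_prefix_decompose[OF M(1), of UNIV k "prefix_upto k ` ?E"]
      emeasure_prefix_decompose[OF N, of UNIV k "prefix_upto k ` ?E"]
    by (simp add: E'[symmetric] single)
qed

lemma exists_pmf_finite_support:
  fixes f :: "nat \<Rightarrow> real"
  assumes "finite S" "\<And>x. f x \<ge> 0" "\<And>x. x \<notin> S \<Longrightarrow> f x = 0" "sum f S = 1"
  shows "\<exists>p. \<forall>x. pmf p x = f x"
proof -
  have "(\<integral>\<^sup>+x. ennreal (f x) \<partial>count_space UNIV) = (\<Sum>x\<in>S. ennreal (f x))"
    using assms by (intro nn_integral_count_space') auto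
  also have "\<dots> = 1" using assms by (simp add: sum_ennreal)
  finally have "pmf (embed_pmf f) x = f x" for x by (intro pmf_embed_pmf) (use assms in auto)
  then show ?thesis by blast
qed

section \<open>Existence and first properties of the run measure\<close>

definition path_prob :: "pwa \<Rightarrow> (nat \<Rightarrow> nat) \<Rightarrow> nat \<Rightarrow> (nat \<Rightarrow> nat) \<Rightarrow> real" where
  "path_prob A w k qs = pa_init A (qs 0) * (\<Prod>i<k. pa_trans A (qs i) (w i) (qs (Suc i)))"

lemma path_prob_0 [simp]: "path_prob A w 0 qs = pa_init A (qs 0)"
  by (simp add: path_prob_def)

lemma path_prob_Suc: "path_prob A w (Suc k) qs = path_prob A w k qs * pa_trans A (qs k) (w k) (qs (Suc k))"
  by (simp add: path_prob_def)

text \<open>\<open>X (n, q)\<close> is the state entered at time \<open>n\<close> when coming from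
  \<open>q\<close>; the start uses the dummy index \<open>(0, 0)\<close>. Since every index contains
  the time, a path never reads a coordinate twice.\<close>

primrec driven_path :: "(nat \<times> nat \<Rightarrow> nat) \<Rightarrow> nat \<Rightarrow> nat" where
  "driven_path X 0 = X (0, 0)"
| "driven_path X (Suc n) = X (Suc n, driven_path X n)"

lemma driven_path_eq_iff:
  "(\<forall>i\<le>k. driven_path X i = qs i) \<longleftrightarrow> X (0, 0) = qs 0 \<and> (\<forall>i<k. X (Suc i, qs i) = qs (Suc i))"
proof (induction k)
  case (Suc k)
  have "(\<forall>i\<le>Suc k. driven_path X i = qs i) \<longleftrightarrow>
      (\<forall>i\<le>k. driven_path X i = qs i) \<and> driven_path X (Suc k) = qs (Suc k)"
    by (auto simp: le_Suc_eq)
  also have "\<dots> \<longleftrightarrow> (\<forall>i\<le>k. driven_path X i = qs i) \<and> X (Suc k, qs k) = qs (Suc k)" by auto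
  finally show ?case using Suc by (auto simp: less_Suc_eq)
qed simp

text \<open>The predicate under the choice operator in \<open>run_measure_def\<close>: once it is
  satisfiable, the chosen measure has all of its properties.\<close>

definition is_run_measure :: "pwa \<Rightarrow> (nat \<Rightarrow> nat) \<Rightarrow> (nat \<Rightarrow> nat) measure \<Rightarrow> bool" where
  "is_run_measure A w M \<longleftrightarrow> prob_space M \<and> sets M = sets seq_space \<and>
     (\<forall>k qs. emeasure M {r \<in> space seq_space. \<forall>i\<le>k. r i = qs i} = ennreal (path_prob A w k qs))"

locale pwa_word =
  fixes \<Sigma> :: "nat set" and A :: pwa and w :: "nat \<Rightarrow> nat"
  assumes finite_alphabet: "finite \<Sigma>" and wf: "wf_pwa \<Sigma> A" and word: "is_word \<Sigma> w"
begin

lemma letter [simp]: "w i \<in> \<Sigma>"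
  using word by (simp add: is_word_def)

lemma finite_states [simp]: "finite (pa_states A)"
  using wf by (simp add: wf_pwa_def)

lemma init_nonneg: "pa_init A q \<ge> 0"
  and init_zero: "q \<notin> pa_states A \<Longrightarrow> pa_init A q = 0"
  and init_sum: "(\<Sum>q\<in>pa_states A. pa_init A q) = 1"
  using wf by (auto simp: wf_pwa_def)

lemma trans_nonneg: "q \<in> pa_states A \<Longrightarrow> pa_trans A q (w i) q' \<ge> 0"
  and trans_zero: "q \<in> pa_states A \<Longrightarrow> q' \<notin> pa_states A \<Longrightarrow> pa_trans A q (w i) q' = 0"
  and trans_sum: "q \<in> pa_states A \<Longrightarrow> (\<Sum>q'\<in>pa_states A. pa_trans A q (w i) q') = 1"
  using wf letter by (auto simp: wf_pwa_def)

text \<open>\<open>wf_pwa\<close> constrains only transitions out of states. Path probabilities are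
  nevertheless under control, because a path that leaves the state set has already picked up a
  factor 0.\<close>

lemma path_prob_nonzero_imp_states:
  "path_prob A w k qs \<noteq> 0 \<Longrightarrow> i \<le> k \<Longrightarrow> qs i \<in> pa_states A"
proof (induction k arbitrary: i)
  case 0
  then show ?case using init_zero by force
next
  case (Suc k)
  then show ?case using trans_zero[of "qs k" "qs (Suc k)" k] by (auto simp: path_prob_Suc le_Suc_eq)
qed

lemma path_prob_nonneg: "path_prob A w k qs \<ge> 0"
proof (induction k)
  case (Suc k)
  then show ?case using path_prob_nonzero_imp_states[of k qs k] trans_nonneg[of "qs k"]
    by (cases "path_prob A w k qs = 0") (auto simp: path_prob_Suc)
qed (simp add: init_nonneg)

lemma path_prob_pos_imp:
  "path_prob A w k qs \<noteq> 0 \<Longrightarrow> pa_init A (qs 0) > 0 \<and> (\<forall>i<k. pa_trans A (qs i) (w i) (qs (Suc i)) > 0)"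
proof (induction k)
  case 0
  then show ?case using init_nonneg[of "qs 0"] by simp
next
  case (Suc k)
  then have "path_prob A w k qs \<noteq> 0" "pa_trans A (qs k) (w k) (qs (Suc k)) \<noteq> 0" by (auto simp: path_prob_Suc)
  with Suc trans_nonneg[of "qs k" k "qs (Suc k)"] path_prob_nonzero_imp_states[of k qs k] show ?case
    by (auto simp: less_Suc_eq)
qed

text \<open>A family of independent random successors, one for each pair of a time and a state,
  drives the run.\<close>

lemma exists_run_measure: "\<exists>M. is_run_measure A w M"
proof -
  have "\<exists>p. \<forall>x. pmf p x = pa_init A x"
    by (intro exists_pmf_finite_support[of "pa_states A"]) (auto simp: init_nonneg init_zero init_sum)
  then obtain p0 where p0: "\<And>x. pmf p0 x = pa_init A x" by blast
  have "\<exists>p. \<forall>x. pmf p x = pa_trans A q (w n) x" if "q \<in> pa_states A" for n q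
    by (intro exists_pmf_finite_support[of "pa_states A"]) (use that in \<open>auto simp: trans_nonneg trans_zero trans_sum\<close>)
  then obtain T where T: "\<And>q n x. q \<in> pa_states A \<Longrightarrow> pmf (T q n) x = pa_trans A q (w n) x" by metis
  define D where "D = (\<lambda>(n, q). case n of 0 \<Rightarrow> p0 | Suc i \<Rightarrow> T q i)"
  interpret D: product_prob_space "\<lambda>i. measure_pmf (D i)" UNIV
    by unfold_locales
  define P where "P = PiM UNIV (\<lambda>i. measure_pmf (D i))"
  have space_P: "space P = UNIV" by (auto simp: P_def space_PiM)
  have coord: "(\<lambda>X. X i) \<in> measurable P (count_space UNIV)" for i
  proof -
    have "(\<lambda>X. X i) \<in> measurable P (measure_pmf (D i))"
      unfolding P_def by (rule measurable_component_singleton) simp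
    then show ?thesis by (simp cong: measurable_cong_sets)
  qed
  have path: "(\<lambda>X. driven_path X n) \<in> measurable P (count_space UNIV)" for n
  proof (induction n)
    case (Suc n)
    have "(\<lambda>X. X (Suc n, driven_path X n)) \<in> measurable P (count_space UNIV)"
      by (rule measurable_compose_countable[where f = "\<lambda>q X. X (Suc n, q)", OF coord Suc])
    then show ?case by simp
  qed (simp add: coord)
  have path_seq: "driven_path \<in> measurable P seq_space"
    unfolding seq_space_def by (rule measurable_PiM_single') (auto simp: path space_P)
  define M where "M = distr P seq_space driven_path"
  have "prob_space P" unfolding P_def by (rule D.P.prob_space_axioms)
  then have "prob_space M" unfolding M_def by (rule prob_space.prob_space_distr[OF _ path_seq])
  moreover have "emeasure M {r \<in> space seq_space. \<forall>i\<le>k. r i = qs i} = ennreal (path_prob A w k qs)" for k qs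
  proof -
    \<comment> \<open>The coordinates read by the cylinder. Their times differ, so independence
      gives a product of single factors.\<close>
    define J where "J = insert (0, 0) ((\<lambda>i. (Suc i, qs i)) ` {..<k})"
    have "{r \<in> space seq_space. \<forall>i\<le>k. r i = qs i} \<in> sets seq_space" by measurable
    then have "emeasure M {r \<in> space seq_space. \<forall>i\<le>k. r i = qs i} =
        emeasure P (driven_path -` {r \<in> space seq_space. \<forall>i\<le>k. r i = qs i} \<inter> space P)"
      unfolding M_def by (rule emeasure_distr[OF path_seq])
    also have "driven_path -` {r \<in> space seq_space. \<forall>i\<le>k. r i = qs i} \<inter> space P =
        {X \<in> space P. \<forall>i\<in>J. X i \<in> {qs (fst i)}}"
      by (auto simp: driven_path_eq_iff J_def)
    also have "emeasure P \<dots> = (\<Prod>i\<in>J. emeasure (measure_pmf (D i)) {qs (fst i)})"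
      unfolding P_def by (rule D.emeasure_PiM_Collect) (auto simp: J_def)
    also have "\<dots> = (\<Prod>i\<in>J. ennreal (pmf (D i) (qs (fst i))))"
      by (simp add: emeasure_pmf_single)
    also have "\<dots> = ennreal (\<Prod>i\<in>J. pmf (D i) (qs (fst i)))"
      by (rule prod_ennreal) simp
    also have "(\<Prod>i\<in>J. pmf (D i) (qs (fst i))) = pa_init A (qs 0) * (\<Prod>i<k. pmf (T (qs i) i) (qs (Suc i)))"
      unfolding J_def
      by (subst prod.insert) (auto simp: prod.reindex inj_on_def D_def p0)
    \<comment> \<open>\<open>T\<close> is specified only at states of the automaton; once a path has
      left them both products are 0.\<close>
    also have "\<dots> = path_prob A w k qs"
    proof (induction k)
      case (Suc k)
      then show ?case using path_prob_nonzero_imp_states[of k qs k] T[of "qs k" k]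
        by (cases "path_prob A w k qs = 0") (auto simp: path_prob_Suc)
    qed simp
    finally show ?thesis .
  qed
  ultimately have "is_run_measure A w M" by (simp add: is_run_measure_def M_def)
  then show ?thesis ..
qed

abbreviation "M \<equiv> run_measure A w"

lemma is_run_measure_M: "is_run_measure A w M"
proof -
  have "run_measure A w = (SOME M. is_run_measure A w M)"
    by (simp add: run_measure_def is_run_measure_def path_prob_def)
  with someI_ex[OF exists_run_measure] show ?thesis by simp
qed

sublocale prob_space M
  using is_run_measure_M by (simp add: is_run_measure_def)

lemma sets_M [simp, measurable_cong]: "sets M = sets seq_space"
  using is_run_measure_M by (simp add: is_run_measure_def)

lemma space_M [simp]: "space M = UNIV"
  using sets_eq_imp_space_eq[OF sets_M] by simp

lemma emeasure_cylinder: "emeasure M {r. \<forall>i\<le>k. r i = qs i} = ennreal (path_prob A w k qs)"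
  using is_run_measure_M by (simp add: is_run_measure_def)

lemma prob_cylinder: "prob {r. \<forall>i\<le>k. r i = qs i} = path_prob A w k qs"
  by (simp add: measure_def emeasure_cylinder path_prob_nonneg)

lemma emeasure_prefix:
  "emeasure M (prefix_upto k -` {p}) = (if length p = Suc k then ennreal (path_prob A w k (\<lambda>i. p ! i)) else 0)"
proof -
  show ?thesis by (simp add: emeasure_cylinder prefix_upto_vimage)
qed

text \<open>A failure shows in some finite prefix of probability 0, and each length has only
  countably many prefixes.\<close>

lemma AE_is_run: "AE r in M. is_run A w r"
proof -
  have "AE r in M. path_prob A w k r \<noteq> 0" for k
  proof -
    have "emeasure M (prefix_upto k -` {p. path_prob A w k (\<lambda>i. p ! i) = 0}) = 0"
      using emeasure_prefix_decompose[OF sets_M, of UNIV k "{p. path_prob A w k (\<lambda>i. p ! i) = 0}"]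
      by (auto simp: emeasure_prefix nn_integral_0_iff_AE AE_count_space)
    then have "prefix_upto k -` {p. path_prob A w k (\<lambda>i. p ! i) = 0} \<in> null_sets M"
      using prefix_set_measurable by (intro null_setsI) (simp_all only: sets_M prefix_set_measurable)
    then have "AE r in M. r \<notin> prefix_upto k -` {p. path_prob A w k (\<lambda>i. p ! i) = 0}"
      by (rule AE_not_in)
    moreover have "path_prob A w k (\<lambda>i. prefix_upto k r ! i) = path_prob A w k r" for r
      unfolding path_prob_def prefix_upto_def by (auto simp del: upt_Suc intro!: prod.cong)
    ultimately show ?thesis by simp
  qed
  then have "AE r in M. \<forall>k. path_prob A w k r \<noteq> 0" by (simp add: AE_all_countable)
  then show ?thesis
  proof eventually_elim
    case (elim r)
    then show ?case using path_prob_pos_imp unfolding is_run_def by (metis lessI)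
  qed
qed

lemma run_states:
  assumes "is_run A w r"
  shows "r i \<in> pa_states A"
proof (induction i)
  case 0
  then show ?case using assms init_zero by (force simp: is_run_def)
next
  case (Suc i)
  then show ?case using assms trans_zero[of "r i" "r (Suc i)" i]
    by (auto simp: is_run_def) (metis less_irrefl)
qed

end

text \<open>Prefix probabilities up to time \<open>k\<close> involve only the first \<open>k\<close>
  letters. A word can thus be continued later without disturbing the probabilities already secured
  for it.\<close>

lemma run_measure_local:
  assumes "pwa_word \<Sigma> A w" "pwa_word \<Sigma> A w'"
    and w: "\<And>i. i < k \<Longrightarrow> w i = w' i"
    and E: "\<And>r r'. (\<And>i. i \<le> k \<Longrightarrow> r i = r' i) \<Longrightarrow> r \<in> E \<Longrightarrow> r' \<in> E"
  shows "measure (run_measure A w) E = measure (run_measure A w') E" "E \<in> sets seq_space"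
proof -
  interpret W: pwa_word \<Sigma> A w by fact
  interpret W': pwa_word \<Sigma> A w' by fact
  have E': "E = prefix_upto k -` (prefix_upto k ` E)"
    using E by (auto simp: prefix_upto_eq_iff)
  show "E \<in> sets seq_space" by (subst E') (rule prefix_set_measurable)
  have "path_prob A w k = path_prob A w' k"
    by (rule ext) (auto simp: path_prob_def w intro!: prod.cong)
  then have "emeasure W.M (prefix_upto k -` {p}) = emeasure W'.M (prefix_upto k -` {p})" for p
    by (simp only: W.emeasure_prefix W'.emeasure_prefix)
  then have "emeasure W.M E = emeasure W'.M E"
    using emeasure_prefix_decompose[OF W.sets_M, of UNIV k "prefix_upto k ` E"]
      emeasure_prefix_decompose[OF W'.sets_M, of UNIV k "prefix_upto k ` E"]
    by (simp add: E'[symmetric])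
  then show "measure (run_measure A w) E = measure (run_measure A w') E" by (simp add: measure_def)
qed

section \<open>Restarting at a state: the Markov property\<close>

definition start_at :: "pwa \<Rightarrow> nat \<Rightarrow> pwa" where
  "start_at A q = A\<lparr>pa_init := (\<lambda>p. if p = q then 1 else 0)\<rparr>"

lemma start_at_simps [simp]:
  "pa_states (start_at A q) = pa_states A"
  "pa_trans (start_at A q) = pa_trans A"
  "pa_wt (start_at A q) = pa_wt A"
  "pa_init (start_at A q) p = (if p = q then 1 else 0)"
  by (simp_all add: start_at_def)

context pwa_word
begin

lemma pwa_word_start_at:
  assumes "q \<in> pa_states A" "is_word \<Sigma> w'"
  shows "pwa_word \<Sigma> (start_at A q) w'"
  using assms wf finite_alphabet by (simp add: pwa_word_def wf_pwa_def)

lemma measurable_shift [measurable]: "(\<lambda>r i. r (t + i)) \<in> measurable seq_space seq_space"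
  unfolding seq_space_def by (rule measurable_PiM_single') (auto simp: space_PiM)

lemma path_prob_append:
  "path_prob A w (t + k) qs =
    path_prob A w t qs * (\<Prod>i<k. pa_trans A (qs (t + i)) (w (t + i)) (qs (t + Suc i)))"
  by (induction k) (auto simp: path_prob_Suc)

text \<open>The product form, instead of a conditional probability, also covers states of
  probability 0. As functions of \<open>E\<close> both sides are finite measures, so it is enough to
  compare them on cylinders.\<close>

lemma markov_property:
  assumes q: "q \<in> pa_states A" and E: "E \<in> sets seq_space"
  shows "prob {r. r t = q \<and> (\<lambda>i. r (t + i)) \<in> E} =
    prob {r. r t = q} * measure (run_measure (start_at A q) (\<lambda>i. w (t + i))) E"
proof -
  have "is_word \<Sigma> (\<lambda>i. w (t + i))" by (simp add: is_word_def)
  then interpret S: pwa_word \<Sigma> "start_at A q" "\<lambda>i. w (t + i)" by (rule pwa_word_start_at[OF q])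
  define X where "X = {r. r t = q}"
  have X: "X \<in> sets seq_space"
    using measurable_sets[OF measurable_coordinate[of t], of "{q}"]
    by (simp add: X_def vimage_def)
  define N1 where "N1 = distr (restrict_space M X) seq_space (\<lambda>r i. r (t + i))"
  define N2 where "N2 = scale_measure (emeasure M X) S.M"
  have shiftM: "(\<lambda>r i. r (t + i)) \<in> measurable (restrict_space M X) seq_space"
    by (rule measurable_restrict_space1) measurable
  have N1: "emeasure N1 Y = emeasure M {r. r t = q \<and> (\<lambda>i. r (t + i)) \<in> Y}" if "Y \<in> sets seq_space" for Y
  proof -
    have "emeasure N1 Y = emeasure (restrict_space M X) ((\<lambda>r i. r (t + i)) -` Y \<inter> space (restrict_space M X))"
      unfolding N1_def by (rule emeasure_distr[OF shiftM that])
    also have "(\<lambda>r i. r (t + i)) -` Y \<inter> space (restrict_space M X) = {r. r t = q \<and> (\<lambda>i. r (t + i)) \<in> Y}"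
      by (auto simp: X_def space_restrict_space)
    also have "emeasure (restrict_space M X) \<dots> = emeasure M \<dots>"
      by (rule emeasure_restrict_space) (use X in \<open>auto simp: X_def\<close>)
    finally show ?thesis .
  qed
  have "N1 = N2"
  proof (rule finite_measure_eqI_cylinders)
    show "sets N1 = sets seq_space" "sets N2 = sets seq_space" by (simp_all add: N1_def N2_def)
    show "finite_measure N1"
    proof (rule finite_measureI)
      have "emeasure N1 (space N1) = emeasure M {r. r t = q \<and> (\<lambda>i. r (t + i)) \<in> UNIV}"
        using N1[of UNIV] sets.top[of seq_space] by (simp add: N1_def)
      then show "emeasure N1 (space N1) \<noteq> \<infinity>" by simp
    qed
    fix k qs
    let ?C = "{r. \<forall>i\<le>k. r i = qs i} :: (nat \<Rightarrow> nat) set"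
    let ?c = "\<Prod>i<k. pa_trans A (qs i) (w (t + i)) (qs (Suc i))"
    have C: "?C \<in> sets seq_space" by simp
    have N2: "emeasure N2 ?C = emeasure M X * ennreal (path_prob (start_at A q) (\<lambda>i. w (t + i)) k qs)"
      by (simp add: N2_def S.emeasure_cylinder)
    show "emeasure N1 ?C = emeasure N2 ?C"
    \<comment> \<open>A cylinder that does not start in \<open>q\<close> is null on both sides; any
      other is split by the prefix up to time \<open>t\<close>.\<close>
    proof (cases "qs 0 = q")
      case False
      then have empty: "{r. r t = q \<and> (\<lambda>i. r (t + i)) \<in> ?C} = {}" by auto
      have "path_prob (start_at A q) (\<lambda>i. w (t + i)) k qs = 0"
        using False by (simp add: path_prob_def)
      show ?thesis using \<open>path_prob (start_at A q) (\<lambda>i. w (t + i)) k qs = 0\<close> unfolding N1[OF C] N2 empty by (metis emeasure_empty ennreal_0 mult_zero_right)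
    next
      case True
      have c: "?c \<ge> 0" and pc: "path_prob (start_at A q) (\<lambda>i. w (t + i)) k qs = ?c"
        using S.path_prob_nonneg[of k qs] True by (simp_all add: path_prob_def)
      define B where "B = {p :: nat list. p ! t = q}"
      have X_eq: "prefix_upto t -` B = X"
        by (auto simp: B_def X_def prefix_upto_def simp del: upt_Suc)
      have "{r. r t = q \<and> (\<lambda>i. r (t + i)) \<in> ?C} = prefix_upto t -` B \<inter> {r. \<forall>i\<le>k. r (t + i) = qs i}"
        by (auto simp: X_eq X_def)
      then have "emeasure N1 ?C =
          (\<integral>\<^sup>+p. emeasure M (prefix_upto t -` {p} \<inter> {r. \<forall>i\<le>k. r (t + i) = qs i}) \<partial>count_space B)"
        by (simp only: N1[OF C]) (rule emeasure_prefix_decompose[OF sets_M cylinder_sets(2)])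
      also have "\<dots> = (\<integral>\<^sup>+p. emeasure M (prefix_upto t -` {p}) * ennreal ?c \<partial>count_space B)"
      proof (rule nn_integral_cong)
        fix p assume "p \<in> space (count_space B)"
        then have pt: "p ! t = q" by (simp add: B_def)
        show "emeasure M (prefix_upto t -` {p} \<inter> {r. \<forall>i\<le>k. r (t + i) = qs i}) =
            emeasure M (prefix_upto t -` {p}) * ennreal ?c"
        proof (cases "length p = Suc t")
          case False
          then have "prefix_upto t -` {p} = {}" by (simp add: prefix_upto_vimage)
          then show ?thesis by simp
        next
          case len: True
          \<comment> \<open>The prefix and the cylinder overlap at time \<open>t\<close>, where both
            have the state \<open>q\<close>; glued together they form one longer cylinder.\<close>
          define qs' where "qs' = (\<lambda>i. if i \<le> t then p ! i else qs (i - t))"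
          have qs'_shift: "qs' (t + i) = qs i" for i
            using pt True by (auto simp: qs'_def)
          have "prefix_upto t -` {p} \<inter> {r. \<forall>i\<le>k. r (t + i) = qs i} = {r. \<forall>i\<le>t + k. r i = qs' i}"
          proof (intro set_eqI iffI)
            fix r assume "r \<in> prefix_upto t -` {p} \<inter> {r. \<forall>i\<le>k. r (t + i) = qs i}"
            then have 1: "\<forall>i\<le>t. r i = p ! i" and 2: "\<forall>i\<le>k. r (t + i) = qs i"
              by (auto simp: prefix_upto_eq_iff_nth)
            have "r i = qs' i" if "i \<le> t + k" for i
              using 1 2[rule_format, of "i - t"] that by (cases "i \<le> t") (auto simp: qs'_def)
            then show "r \<in> {r. \<forall>i\<le>t + k. r i = qs' i}" by simp
          next
            fix r assume r: "r \<in> {r. \<forall>i\<le>t + k. r i = qs' i}"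
            then have "\<forall>i\<le>t. r i = p ! i" by (auto simp: qs'_def)
            moreover have "\<forall>i\<le>k. r (t + i) = qs i" using r by (auto simp: qs'_shift)
            ultimately show "r \<in> prefix_upto t -` {p} \<inter> {r. \<forall>i\<le>k. r (t + i) = qs i}"
              using len by (auto simp: prefix_upto_eq_iff_nth)
          qed
          then have "emeasure M (prefix_upto t -` {p} \<inter> {r. \<forall>i\<le>k. r (t + i) = qs i}) =
              ennreal (path_prob A w (t + k) qs')" by (simp add: emeasure_cylinder)
          also have "path_prob A w (t + k) qs' = path_prob A w t qs' * ?c"
            by (simp add: path_prob_append qs'_shift flip: add_Suc_right)
          also have "path_prob A w t qs' = path_prob A w t (\<lambda>i. p ! i)"
            by (auto simp: path_prob_def qs'_def intro!: prod.cong)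
          finally show ?thesis using len c by (simp add: emeasure_prefix ennreal_mult path_prob_nonneg)
        qed
      qed
      also have "\<dots> = (\<integral>\<^sup>+p. emeasure M (prefix_upto t -` {p}) \<partial>count_space B) * ennreal ?c"
        by (rule nn_integral_multc) simp
      also have "(\<integral>\<^sup>+p. emeasure M (prefix_upto t -` {p}) \<partial>count_space B) = emeasure M X"
        using emeasure_prefix_decompose[OF sets_M, of UNIV t B] sets.top[of seq_space] by (simp add: X_eq)
      finally show ?thesis by (simp add: N2 pc)
    qed
  qed
  then have "emeasure M {r. r t = q \<and> (\<lambda>i. r (t + i)) \<in> E} = emeasure M X * emeasure S.M E"
    using N1[OF E] by (simp add: N2_def)
  then show ?thesis by (simp add: measure_def enn2real_mult X_def)
qed

end

subsection \<open>Values of a word\<close>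

text \<open>A sum instead of a maximum: it bounds every weight without any nonemptiness
  condition.\<close>

definition wt_bound :: "nat set \<Rightarrow> pwa \<Rightarrow> real" where
  "wt_bound \<Sigma> A = (\<Sum>q\<in>pa_states A. \<Sum>\<sigma>\<in>\<Sigma>. \<Sum>q'\<in>pa_states A. \<bar>pa_wt A q \<sigma> q'\<bar>)"

lemma wt_bound_nonneg: "wt_bound \<Sigma> A \<ge> 0"
  unfolding wt_bound_def by (intro sum_nonneg) auto

lemma wt_bound_start_at [simp]: "wt_bound \<Sigma> (start_at A q) = wt_bound \<Sigma> A"
  by (simp add: wt_bound_def)

lemma run_weights_start_at [simp]: "run_weights (start_at A q) = run_weights A"
  by (intro ext) (simp add: run_weights_def)

context pwa_word
begin

lemma abs_wt_le:
  assumes "q \<in> pa_states A" "\<sigma> \<in> \<Sigma>" "q' \<in> pa_states A"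
  shows "\<bar>pa_wt A q \<sigma> q'\<bar> \<le> wt_bound \<Sigma> A"
proof -
  let ?g = "\<lambda>q \<sigma>. \<Sum>q'\<in>pa_states A. \<bar>pa_wt A q \<sigma> q'\<bar>"
  have "\<bar>pa_wt A q \<sigma> q'\<bar> \<le> ?g q \<sigma>"
    by (rule member_le_sum[of q' _ "\<lambda>q'. \<bar>pa_wt A q \<sigma> q'\<bar>"]) (use assms in auto)
  also have "\<dots> \<le> (\<Sum>\<sigma>\<in>\<Sigma>. ?g q \<sigma>)"
    by (rule member_le_sum[of \<sigma> _ "?g q"]) (use assms finite_alphabet in \<open>auto intro: sum_nonneg\<close>)
  also have "\<dots> \<le> wt_bound \<Sigma> A"
    unfolding wt_bound_def
    by (rule member_le_sum[of q _ "\<lambda>q. \<Sum>\<sigma>\<in>\<Sigma>. ?g q \<sigma>"]) (use assms in \<open>auto intro!: sum_nonneg\<close>)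
  finally show ?thesis .
qed

lemma abs_run_weights_le:
  assumes "is_run A w r"
  shows "\<bar>run_weights A w r i\<bar> \<le> wt_bound \<Sigma> A"
  unfolding run_weights_def by (intro abs_wt_le run_states[OF assms] letter)

lemma measurable_run_weights [measurable]:
  "(\<lambda>r. run_weights A w r i) \<in> borel_measurable seq_space"
  unfolding run_weights_def
  by (rule measurable_compose_countable[where f = "\<lambda>q r. pa_wt A q (w i) (r (Suc i))" and g = "\<lambda>r. r i"])
     (auto intro: measurable_compose[OF measurable_coordinate])

lemma measurable_LimAvg [measurable]:
  "(\<lambda>r. LimAvg (run_weights A w r)) \<in> borel_measurable seq_space"
  unfolding LimAvg_def by measurable

lemma runs_ge_sets: "runs_ge A w \<eta> \<in> sets seq_space"
proof -
  have [measurable]: "Measurable.pred seq_space (\<lambda>r. pa_init A (r 0) > 0)"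
    using measurable_compose[OF measurable_coordinate[of 0], of "\<lambda>q. pa_init A q > 0" "count_space UNIV"] by simp
  have [measurable]: "Measurable.pred seq_space (\<lambda>r. pa_trans A (r i) (w i) (r (Suc i)) > 0)" for i
    by (rule measurable_compose_countable[where f = "\<lambda>q r. pa_trans A q (w i) (r (Suc i)) > 0" and g = "\<lambda>r. r i"])
      (auto intro: measurable_compose[OF measurable_coordinate])
  show ?thesis unfolding runs_ge_def is_run_def by measurable
qed

lemma AE_LimAvg_ge_iff: "prob (runs_ge A w \<eta>) = 1 \<longleftrightarrow> (AE r in M. \<eta> \<le> LimAvg (run_weights A w r))"
proof -
  have "prob (runs_ge A w \<eta>) = 1 \<longleftrightarrow> (AE r in M. r \<in> runs_ge A w \<eta>)"
    using AE_in_set_eq_1 runs_ge_sets by simp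
  also have "\<dots> \<longleftrightarrow> (AE r in M. \<eta> \<le> LimAvg (run_weights A w r))"
    using AE_is_run by (auto elim: eventually_elim2 simp: runs_ge_def)
  finally show ?thesis .
qed

lemma AE_LimAvg_less_iff: "prob (runs_ge A w \<eta>) = 0 \<longleftrightarrow> (AE r in M. LimAvg (run_weights A w r) < \<eta>)"
proof -
  have "prob (runs_ge A w \<eta>) = 0 \<longleftrightarrow> (AE r in M. r \<notin> runs_ge A w \<eta>)"
    by (intro prob_eq_0) (simp add: runs_ge_sets)
  also have "\<dots> \<longleftrightarrow> (AE r in M. LimAvg (run_weights A w r) < \<eta>)"
    using AE_is_run by (auto elim: eventually_elim2 simp: runs_ge_def)
  finally show ?thesis .
qed

lemma AE_LimAvg_bounds:
  "AE r in M. - wt_bound \<Sigma> A \<le> LimAvg (run_weights A w r) \<and> LimAvg (run_weights A w r) \<le> wt_bound \<Sigma> A"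
  using AE_is_run
proof eventually_elim
  case (elim r)
  then show ?case using LimAvg_le_bound[of "run_weights A w r", OF abs_run_weights_le] by auto
qed

lemma AE_False: "\<not> (AE r in M. False)"
  using emeasure_space_1 by (simp add: AE_False)

text \<open>With \<open>prob_runs_ge_upper\<close> this makes the threshold sets in
  \<open>pos_sem\<close> and \<open>as_sem\<close> nonempty and bounded above, so that their real
  suprema are meaningful.\<close>

lemma prob_runs_ge_lower: "prob (runs_ge A w (- wt_bound \<Sigma> A)) = 1"
  unfolding AE_LimAvg_ge_iff using AE_LimAvg_bounds by auto

lemma prob_runs_ge_upper:
  assumes "prob (runs_ge A w \<eta>) > 0"
  shows "\<eta> \<le> wt_bound \<Sigma> A"
proof (rule ccontr)
  assume "\<not> \<eta> \<le> wt_bound \<Sigma> A"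
  then have "AE r in M. LimAvg (run_weights A w r) < \<eta>"
    using AE_LimAvg_bounds by (auto elim: eventually_mono)
  then show False using assms unfolding AE_LimAvg_less_iff[symmetric] by simp
qed

lemma pos_sem_lessD:
  assumes "pos_sem A w < d"
  shows "AE r in M. LimAvg (run_weights A w r) < d"
proof (rule ccontr)
  assume "\<not> ?thesis"
  then have "prob (runs_ge A w d) > 0"
    unfolding AE_LimAvg_less_iff[symmetric] by (simp add: zero_less_measure_iff)
  then have "d \<le> pos_sem A w"
    unfolding pos_sem_def by (intro cSup_upper bdd_aboveI[of _ "wt_bound \<Sigma> A"]) (auto intro: prob_runs_ge_upper)
  with assms show False by simp
qed

lemma pos_sem_leI:
  assumes "AE r in M. LimAvg (run_weights A w r) \<le> d"
  shows "pos_sem A w \<le> d"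
  unfolding pos_sem_def
proof (rule cSup_least)
  have "- wt_bound \<Sigma> A \<in> {\<eta>. prob (runs_ge A w \<eta>) > 0}" by (simp add: prob_runs_ge_lower)
  then show "{\<eta>. prob (runs_ge A w \<eta>) > 0} \<noteq> {}" by blast
  fix \<eta> assume "\<eta> \<in> {\<eta>. prob (runs_ge A w \<eta>) > 0}"
  then have "\<not> (AE r in M. LimAvg (run_weights A w r) < \<eta>)"
    unfolding AE_LimAvg_less_iff[symmetric] by simp
  moreover have "AE r in M. LimAvg (run_weights A w r) < \<eta>" if "d < \<eta>"
    using assms by eventually_elim (use that in simp)
  ultimately show "\<eta> \<le> d" by (meson not_le)
qed

lemma pos_sem_geI: "prob (runs_ge A w c) > 0 \<Longrightarrow> c \<le> pos_sem A w"
  unfolding pos_sem_def by (intro cSup_upper bdd_aboveI[of _ "wt_bound \<Sigma> A"]) (auto intro: prob_runs_ge_upper)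

lemma as_sem_greaterD:
  assumes "c < as_sem A w"
  shows "AE r in M. c \<le> LimAvg (run_weights A w r)"
proof -
  have "- wt_bound \<Sigma> A \<in> {\<eta>. prob (runs_ge A w \<eta>) = 1}" by (simp add: prob_runs_ge_lower)
  then have "{\<eta>. prob (runs_ge A w \<eta>) = 1} \<noteq> {}" by blast
  from less_cSupD[OF this assms[unfolded as_sem_def]]
  obtain \<eta> where "prob (runs_ge A w \<eta>) = 1" "c < \<eta>" by auto
  then show ?thesis unfolding AE_LimAvg_ge_iff by (auto elim!: eventually_mono)
qed

lemma as_sem_geI:
  assumes "AE r in M. c \<le> LimAvg (run_weights A w r)"
  shows "c \<le> as_sem A w"
  unfolding as_sem_def
  by (rule cSup_upper)
    (use assms in \<open>auto simp: AE_LimAvg_ge_iff[symmetric] intro!: bdd_aboveI[of _ "wt_bound \<Sigma> A"] prob_runs_ge_upper\<close>)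

lemma as_sem_leI:
  assumes "\<And>\<eta>. d < \<eta> \<Longrightarrow> prob (runs_ge A w \<eta>) < 1"
  shows "as_sem A w \<le> d"
  unfolding as_sem_def
proof (rule cSup_least)
  have "- wt_bound \<Sigma> A \<in> {\<eta>. prob (runs_ge A w \<eta>) = 1}" by (simp add: prob_runs_ge_lower)
  then show "{\<eta>. prob (runs_ge A w \<eta>) = 1} \<noteq> {}" by blast
qed (metis assms mem_Collect_eq less_irrefl not_le)

lemma exists_run: "\<exists>r. is_run A w r"
  using AE_is_run AE_False by (metis (mono_tags, lifting) eventually_mono)

lemma nd_sem_greaterD:
  assumes "c < nd_sem A w"
  shows "\<exists>r. is_run A w r \<and> c < LimAvg (run_weights A w r)"
proof -
  have "{LimAvg (run_weights A w r) | r. is_run A w r} \<noteq> {}" using exists_run by auto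
  from less_cSupD[OF this assms[unfolded nd_sem_def]] show ?thesis by auto
qed

lemma nd_sem_geI:
  assumes "is_run A w r" "c \<le> LimAvg (run_weights A w r)"
  shows "c \<le> nd_sem A w"
proof -
  have "LimAvg (run_weights A w r) \<le> nd_sem A w"
    unfolding nd_sem_def
    by (intro cSup_upper bdd_aboveI[of _ "wt_bound \<Sigma> A"])
      (use assms LimAvg_le_bound(2)[OF abs_run_weights_le] in auto)
  with assms show ?thesis by simp
qed

lemma nd_sem_leI:
  assumes "\<And>r. is_run A w r \<Longrightarrow> LimAvg (run_weights A w r) \<le> d"
  shows "nd_sem A w \<le> d"
  unfolding nd_sem_def by (rule cSup_least) (use exists_run assms in auto)

end

subsection \<open>Three automata\<close>

context pwa_word
begin

text \<open>The cylinders around \<open>qs\<close> decrease to the single path. For words with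
  finitely many ones, one run of positive probability decides the values of \<open>inf_aut\<close>
  and, under \<open>pos_sem\<close>, of \<open>fin_aut\<close>.\<close>

lemma prob_singleton_ge:
  assumes "\<And>k. c \<le> path_prob A w k qs"
  shows "c \<le> prob {qs}" "{qs} \<in> sets seq_space"
proof -
  have eq: "{qs} = (\<Inter>k. {r. \<forall>i\<le>k. r i = qs i})" by (auto simp: fun_eq_iff)
  show "{qs} \<in> sets seq_space" unfolding eq by (intro sets.countable_INT) auto
  have "(\<lambda>k. prob {r. \<forall>i\<le>k. r i = qs i}) \<longlonglongrightarrow> prob (\<Inter>k. {r. \<forall>i\<le>k. r i = qs i})"
    by (intro finite_Lim_measure_decseq) (auto simp: decseq_def)
  then show "c \<le> prob {qs}"
    unfolding eq by (rule LIMSEQ_le_const) (use assms in \<open>auto simp: prob_cylinder\<close>)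
qed

lemma state_sets [simp]: "{r. r n = q} \<in> sets seq_space"
  using measurable_sets[OF measurable_coordinate[of n], of "{q}"] by (simp add: vimage_def)

lemma prob_state_partition:
  assumes "E \<in> sets seq_space"
  shows "prob E = (\<Sum>q\<in>pa_states A. prob {r. r n = q \<and> r \<in> E})"
proof -
  have sets: "{r. r n = q \<and> r \<in> E} \<in> sets seq_space" for q
    using sets.Int[OF state_sets[of n q] assms] by (simp add: Int_def)
  have "prob E = prob (\<Union>q\<in>pa_states A. {r. r n = q \<and> r \<in> E})"
  proof (rule finite_measure_eq_AE)
    show "AE r in M. r \<in> E \<longleftrightarrow> r \<in> (\<Union>q\<in>pa_states A. {r. r n = q \<and> r \<in> E})"
      using AE_is_run by eventually_elim (use run_states in auto)
  qed (use assms sets in \<open>auto intro!: sets.finite_UN\<close>)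
  also have "\<dots> = (\<Sum>q\<in>pa_states A. prob {r. r n = q \<and> r \<in> E})"
    by (rule finite_measure_finite_Union) (use sets in \<open>auto simp: disjoint_family_on_def\<close>)
  finally show ?thesis .
qed

lemma prob_first_state: "prob {r. r 0 = q} = pa_init A q"
  using prob_cylinder[of 0 "\<lambda>_. q"] by simp

text \<open>Forward recursion for the state distribution, with the one-step law taken from the
  Markov property; it drives the survival computation.\<close>

lemma prob_state_Suc:
  "prob {r. r (Suc n) = q'} = (\<Sum>q\<in>pa_states A. prob {r. r n = q} * pa_trans A q (w n) q')"
proof -
  have "prob {r. r n = q \<and> r (Suc n) = q'} = prob {r. r n = q} * pa_trans A q (w n) q'"
    if q: "q \<in> pa_states A" for q
  proof -
    have "is_word \<Sigma> (\<lambda>i. w (n + i))" by (simp add: is_word_def)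
    then interpret S: pwa_word \<Sigma> "start_at A q" "\<lambda>i. w (n + i)" by (rule pwa_word_start_at[OF q])
    define qs where "qs = (\<lambda>i::nat. if i = 0 then q else q')"
    have "S.prob {r. r (Suc 0) = q'} = S.prob {r. \<forall>i\<le>1. r i = qs i}"
    proof (rule S.finite_measure_eq_AE)
      show "AE r in S.M. r \<in> {r. r (Suc 0) = q'} \<longleftrightarrow> r \<in> {r. \<forall>i\<le>1. r i = qs i}"
        using S.AE_is_run
      proof eventually_elim
        case (elim r)
        then have "r 0 = q" by (simp add: is_run_def split: if_splits)
        moreover have "(\<forall>i\<le>1. r i = qs i) \<longleftrightarrow> r 0 = qs 0 \<and> r 1 = qs 1"
          by (metis One_nat_def le_Suc_eq le_zero_eq order_refl zero_le)
        ultimately show ?case by (simp add: qs_def)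
      qed
    qed (simp_all only: S.sets_M state_sets cylinder_sets)
    also have "\<dots> = path_prob (start_at A q) (\<lambda>i. w (n + i)) 1 qs"
      by (rule S.prob_cylinder)
    also have "\<dots> = pa_trans A q (w n) q'"
      by (simp add: path_prob_def qs_def)
    finally show ?thesis
      using markov_property[OF q state_sets[of "Suc 0" q'], of n] by (simp only: mem_Collect_eq add_Suc_right add_0_right)
  qed
  then show ?thesis
    unfolding prob_state_partition[OF state_sets[of "Suc n" q'], of n] mem_Collect_eq
    by (intro sum.cong refl)
qed

end

lemma binary_word: "is_word {0, 1} w \<Longrightarrow> w i = 0 \<or> w i = 1"
  by (auto simp: is_word_def)

text \<open>Each letter 1 offers an escape to the absorbing, rewarding state 1 with probability 1/2.
  Staying in 0 for ever thus has probability 0 exactly if there are infinitely many ones.\<close>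

definition inf_aut :: pwa where
  "inf_aut = \<lparr>pa_states = {0, 1}, pa_init = (\<lambda>q. if q = 0 then 1 else 0),
     pa_trans = (\<lambda>q \<sigma> q'.
       if q = 0 \<and> \<sigma> = 1 then (if q' \<in> {0, 1} then 1 / 2 else 0)
       else if q' = q then 1 else 0),
     pa_wt = (\<lambda>q \<sigma> q'. if q = 1 then 1 else 0)\<rparr>"

text \<open>Leaving state 0 is a guess that no letter 1 follows. A wrong guess ends in the sink 2,
  and waiting for ever earns nothing.\<close>

definition fin_aut :: pwa where
  "fin_aut = \<lparr>pa_states = {0, 1, 2}, pa_init = (\<lambda>q. if q = 0 then 1 else 0),
     pa_trans = (\<lambda>q \<sigma> q'.
       if q = 0 then (if q' \<in> {0, 1} then 1 / 2 else 0)
       else if q = 1 \<and> \<sigma> = 1 then (if q' = 2 then 1 else 0)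
       else if q' = q then 1 else 0),
     pa_wt = (\<lambda>q \<sigma> q'. if q = 1 then 1 else 0)\<rparr>"

text \<open>In state 0 the letter 1 is fatal (state 2), and every letter 0 escapes to the safe
  state 1 with probability 1/2; the letter 1 leads from state 1 back to state 0. Hence a block
  of k letters 0 followed by the letter 1 is survived with probability 1 - (1/2)^k.\<close>

definition survival_aut :: pwa where
  "survival_aut = \<lparr>pa_states = {0, 1, 2}, pa_init = (\<lambda>q. if q = 0 then 1 else 0),
     pa_trans = (\<lambda>q \<sigma> q'.
       if q = 0 then (if \<sigma> = 0 then (if q' \<in> {0, 1} then 1 / 2 else 0) else if q' = 2 then 1 else 0)
       else if q = 1 then (if \<sigma> = 0 then (if q' = 1 then 1 else 0) else if q' = 0 then 1 else 0)
       else if q' = q then 1 else 0),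
     pa_wt = (\<lambda>q \<sigma> q'. if q = 2 then 0 else 1)\<rparr>"

lemma wf_inf_aut: "wf_pwa {0, 1} inf_aut"
  by (auto simp: wf_pwa_def inf_aut_def)

lemma wf_fin_aut: "wf_pwa {0, 1} fin_aut"
  by (auto simp: wf_pwa_def fin_aut_def)

lemma wf_survival_aut: "wf_pwa {0, 1} survival_aut"
  by (auto simp: wf_pwa_def survival_aut_def)

lemma pwa_wordI: "wf_pwa {0, 1} A \<Longrightarrow> is_word {0, 1} w \<Longrightarrow> pwa_word {0, 1} A w"
  by (simp add: pwa_word_def)

lemma absorbing_stays:
  assumes "is_run A w r" "r i = q" "i \<le> j" "\<And>\<sigma> q'. pa_trans A q \<sigma> q' = (if q' = q then 1 else 0)"
  shows "r j = q"
  using assms(3,2)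
proof (induction j rule: dec_induct)
  case (step n)
  then show ?case using assms(1,4) by (auto simp: is_run_def split: if_splits) (metis less_irrefl)
qed

lemma infinite_ones_iff:
  fixes w :: "nat \<Rightarrow> nat"
  shows "infinite {i. w i = 1} \<longleftrightarrow> (\<forall>N. \<exists>i\<ge>N. w i = 1)"
  unfolding infinite_nat_iff_unbounded_le by simp

subsection \<open>Infinitely many ones\<close>

lemma path_prob_inf_aut: "path_prob inf_aut w k (\<lambda>_. 0) = (1 / 2) ^ card {i. i < k \<and> w i = 1}"
proof (induction k)
  case (Suc k)
  have "{i. i < Suc k \<and> w i = 1} = {i. i < k \<and> w i = 1} \<union> (if w k = 1 then {k} else {})"
    by (auto simp: less_Suc_eq)
  then have "card {i. i < Suc k \<and> w i = 1} = card {i. i < k \<and> w i = 1} + (if w k = 1 then 1 else 0)"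
    by (auto simp: card_insert_if)
  with Suc show ?case by (auto simp: path_prob_Suc inf_aut_def)
qed (simp add: inf_aut_def)

lemma LimAvg_inf_aut:
  assumes "is_word {0, 1} w" "is_run inf_aut w r"
  shows "LimAvg (run_weights inf_aut w r) = (if \<forall>i. r i = 0 then 0 else 1)"
proof (cases "\<forall>i. r i = 0")
  case True
  then have "LimAvg (run_weights inf_aut w r) = 0"
    by (intro LimAvg_eventually_const[of 0]) (auto simp: run_weights_def inf_aut_def)
  with True show ?thesis by simp
next
  case False
  interpret pwa_word "{0, 1}" inf_aut w by (intro pwa_wordI wf_inf_aut assms)
  from False obtain i where "r i \<noteq> 0" by blast
  with run_states[OF assms(2), of i] have "r i = 1" by (auto simp: inf_aut_def)
  then have "r j = 1" if "i \<le> j" for j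
    by (intro absorbing_stays[OF assms(2) _ that]) (auto simp: inf_aut_def)
  then have "LimAvg (run_weights inf_aut w r) = 1"
    by (intro LimAvg_eventually_const[of i]) (auto simp: run_weights_def inf_aut_def)
  with False show ?thesis by simp
qed

text \<open>Exactly the runs that leave state 0 have limit average 1. With finitely many ones the
  run that stays has positive probability, so no positive threshold is met almost surely.\<close>

lemma as_sem_inf_aut:
  assumes w: "is_word {0, 1} w"
  shows "as_sem inf_aut w = (if infinite {i. w i = 1} then 1 else 0)"
proof -
  interpret pwa_word "{0, 1}" inf_aut w by (intro pwa_wordI wf_inf_aut w)
  have AE: "AE r in M. LimAvg (run_weights inf_aut w r) = (if \<forall>i. r i = 0 then 0 else 1)"
    using AE_is_run by eventually_elim (rule LimAvg_inf_aut[OF w])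
  show ?thesis
  proof (cases "infinite {i. w i = 1}")
    case True
    have sets: "{r. \<forall>i. r i = 0} \<in> sets seq_space"
    proof -
      have "{r \<in> space seq_space. \<forall>i. r i = 0} \<in> sets seq_space" by measurable
      then show ?thesis by simp
    qed
    have bound: "prob {r. \<forall>i. r i = 0} \<le> (1 / 2) ^ m" for m
    proof -
      obtain F where F: "F \<subseteq> {i. w i = 1}" "finite F" "card F = m"
        using True by (meson infinite_arbitrarily_large)
      define k where "k = Suc (Max (insert 0 F))"
      have "F \<subseteq> {i. i < k \<and> w i = 1}" using F by (auto simp: k_def less_Suc_eq_le)
      then have m: "m \<le> card {i. i < k \<and> w i = 1}" using F by (metis card_mono finite_Collect_conjI finite_Collect_less_nat)
      have "prob {r. \<forall>i. r i = 0} \<le> prob {r. \<forall>i\<le>k. r i = 0}"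
        by (intro finite_measure_mono) auto
      also have "\<dots> = (1 / 2) ^ card {i. i < k \<and> w i = 1}"
        using prob_cylinder[of k "\<lambda>_. 0"] by (simp add: path_prob_inf_aut)
      also have "\<dots> \<le> (1 / 2) ^ m" using m by (intro power_decreasing) auto
      finally show ?thesis .
    qed
    have "(\<lambda>m. (1 / 2 :: real) ^ m) \<longlonglongrightarrow> 0" by (intro LIMSEQ_realpow_zero) auto
    then have "prob {r. \<forall>i. r i = 0} \<le> 0"
      by (rule LIMSEQ_le_const) (use bound in auto)
    then have "prob {r. \<forall>i. r i = 0} = 0" by (simp add: measure_le_0_iff)
    then have "AE r in M. r \<notin> {r. \<forall>i. r i = 0}" using sets by (subst (asm) prob_eq_0) auto
    with AE have one: "AE r in M. LimAvg (run_weights inf_aut w r) = 1" by eventually_elim auto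
    have "1 \<le> as_sem inf_aut w" by (rule as_sem_geI) (use one in \<open>auto elim!: eventually_mono\<close>)
    moreover have "as_sem inf_aut w \<le> 1"
    proof (rule as_sem_leI)
      fix \<eta> :: real assume \<eta>: "1 < \<eta>"
      have "prob (runs_ge inf_aut w \<eta>) = 0"
        unfolding AE_LimAvg_less_iff using one by eventually_elim (use \<eta> in simp)
      then show "prob (runs_ge inf_aut w \<eta>) < 1" by simp
    qed
    ultimately show ?thesis using True by simp
  next
    case False
    define c :: real where "c = (1 / 2) ^ card {i. w i = 1}"
    have "c \<le> path_prob inf_aut w k (\<lambda>_. 0)" for k
      unfolding path_prob_inf_aut c_def using False by (intro power_decreasing card_mono) auto
    from prob_singleton_ge[OF this] have sing: "c \<le> prob {\<lambda>_. 0}" "{\<lambda>_. 0} \<in> sets seq_space" .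
    have "0 \<le> as_sem inf_aut w"
      by (rule as_sem_geI) (use AE in \<open>auto elim!: eventually_mono\<close>)
    moreover have "as_sem inf_aut w \<le> 0"
    proof (rule as_sem_leI)
      fix \<eta> :: real assume \<eta>: "0 < \<eta>"
      have "runs_ge inf_aut w \<eta> \<subseteq> space M - {\<lambda>_. 0}"
        using \<eta> by (auto simp: runs_ge_def LimAvg_inf_aut[OF w] fun_eq_iff split: if_splits)
      then have "prob (runs_ge inf_aut w \<eta>) \<le> prob (space M - {\<lambda>_. 0})"
        by (rule finite_measure_mono[OF _ sets.compl_sets]) (simp add: sing(2))
      also have "\<dots> = 1 - prob {\<lambda>_. 0}" using sing by (intro prob_compl) simp
      also have "\<dots> < 1" using less_le_trans[OF _ sing(1), of 0] by (simp add: c_def)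
      finally show "prob (runs_ge inf_aut w \<eta>) < 1" .
    qed
    ultimately show ?thesis using False by simp
  qed
qed

subsection \<open>Finitely many ones\<close>

text \<open>A run either waits in 0 for ever, or has left 0 when a later 1 is read and is then
  absorbed in 2. As this concerns every run, it serves both semantics.\<close>

lemma LimAvg_fin_aut_infinite:
  assumes w: "is_word {0, 1} w" "infinite {i. w i = 1}" and r: "is_run fin_aut w r"
  shows "LimAvg (run_weights fin_aut w r) = 0"
proof (cases "\<forall>i. r i = 0")
  case True
  then show ?thesis
    by (intro LimAvg_eventually_const[of 0]) (auto simp: run_weights_def fin_aut_def)
next
  case False
  interpret pwa_word "{0, 1}" fin_aut w by (intro pwa_wordI wf_fin_aut w)
  have step: "pa_trans fin_aut (r i) (w i) (r (Suc i)) > 0" for i using r by (simp add: is_run_def)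
  from False obtain i where i: "r i \<noteq> 0" by blast
  from w(2) obtain j where j: "j \<ge> i" "w j = 1" unfolding infinite_ones_iff by blast
  have "r k \<noteq> 0" if "i \<le> k" for k
    using that i
  proof (induction k rule: dec_induct)
    case (step n)
    then show ?case using \<open>\<And>i. pa_trans fin_aut (r i) (w i) (r (Suc i)) > 0\<close>[of n]
      by (auto simp: fin_aut_def split: if_splits)
  qed
  with j(1) have "r j \<noteq> 0" by blast
  then have "r (Suc j) = 2"
    using step[of j] j(2) run_states[OF r, of j] by (auto simp: fin_aut_def split: if_splits)
  then have "r k = 2" if "Suc j \<le> k" for k
    by (intro absorbing_stays[OF r _ that]) (auto simp: fin_aut_def)
  then show ?thesis
    by (intro LimAvg_eventually_const[of "Suc j"]) (auto simp: run_weights_def fin_aut_def)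
qed

lemma LimAvg_fin_aut_le: "LimAvg (run_weights fin_aut w r) \<le> 1"
  by (rule LimAvg_le_bound) (auto simp: run_weights_def fin_aut_def)

text \<open>The run waits until no letter 1 is left. It pays a factor 1/2 for each of the
  \<open>N + 1\<close> transitions out of 0 and nothing afterwards.\<close>

lemma fin_aut_good_run:
  assumes "\<And>i. i \<ge> N \<Longrightarrow> w i = 0"
  defines "r \<equiv> \<lambda>i. if i \<le> N then 0 else 1"
  shows "is_run fin_aut w r" "LimAvg (run_weights fin_aut w r) = 1"
    "(1 / 2) ^ Suc N \<le> path_prob fin_aut w k r"
proof -
  show "is_run fin_aut w r" using assms by (auto simp: is_run_def fin_aut_def)
  show "LimAvg (run_weights fin_aut w r) = 1"
    by (rule LimAvg_eventually_const[of "Suc N"]) (auto simp: run_weights_def fin_aut_def r_def)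
  have "path_prob fin_aut w k r = (1 / 2) ^ min k (Suc N)"
  proof (induction k)
    case (Suc k)
    then show ?case using assms(1)[of k]
      by (cases "k \<le> N") (auto simp: path_prob_Suc fin_aut_def r_def min_def not_less_eq_eq)
  qed (simp add: fin_aut_def r_def)
  then show "(1 / 2) ^ Suc N \<le> path_prob fin_aut w k r"
    by (simp only:) (intro power_decreasing, auto)
qed

lemma finite_ones_eventually_zero:
  assumes "is_word {0, 1} w" "finite {i. w i = 1}"
  obtains N where "\<And>i. i \<ge> N \<Longrightarrow> w i = 0"
  using assms infinite_ones_iff[of w] binary_word[of w] by metis

lemma nd_sem_fin_aut:
  assumes w: "is_word {0, 1} w"
  shows "nd_sem fin_aut w = (if finite {i. w i = 1} then 1 else 0)"
proof -
  interpret pwa_word "{0, 1}" fin_aut w by (intro pwa_wordI wf_fin_aut w)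
  show ?thesis
  proof (cases "finite {i. w i = 1}")
    case True
    obtain N where N: "\<And>i. i \<ge> N \<Longrightarrow> w i = 0" using finite_ones_eventually_zero[OF w True] by blast
    have "1 \<le> nd_sem fin_aut w"
      by (rule nd_sem_geI[OF fin_aut_good_run(1)[OF N]]) (simp, rule eq_refl, rule fin_aut_good_run(2)[OF N, symmetric])
    moreover have "nd_sem fin_aut w \<le> 1" by (rule nd_sem_leI) (rule LimAvg_fin_aut_le)
    ultimately show ?thesis using True by simp
  next
    case False
    obtain r where r: "is_run fin_aut w r" using exists_run ..
    have "0 \<le> nd_sem fin_aut w"
      by (rule nd_sem_geI[OF r]) (simp add: LimAvg_fin_aut_infinite[OF w False r])
    moreover have "nd_sem fin_aut w \<le> 0"
      by (rule nd_sem_leI) (simp add: LimAvg_fin_aut_infinite[OF w False])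
    ultimately show ?thesis using False by simp
  qed
qed

lemma pos_sem_fin_aut:
  assumes w: "is_word {0, 1} w"
  shows "pos_sem fin_aut w = (if finite {i. w i = 1} then 1 else 0)"
proof -
  interpret pwa_word "{0, 1}" fin_aut w by (intro pwa_wordI wf_fin_aut w)
  show ?thesis
  proof (cases "finite {i. w i = 1}")
    case True
    obtain N where N: "\<And>i. i \<ge> N \<Longrightarrow> w i = 0" using finite_ones_eventually_zero[OF w True] by blast
    define r where "r = (\<lambda>i. if i \<le> N then 0 else 1 :: nat)"
    have "(1 / 2) ^ Suc N \<le> prob {r}"
      unfolding r_def by (rule prob_singleton_ge(1)) (rule fin_aut_good_run(3)[OF N])
    moreover have "prob {r} \<le> prob (runs_ge fin_aut w 1)"
      by (intro finite_measure_mono)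
        (auto simp: runs_ge_sets, auto simp: runs_ge_def r_def fin_aut_good_run[OF N])
    moreover have "(0::real) < (1 / 2) ^ Suc N" by simp
    ultimately have "1 \<le> pos_sem fin_aut w" by (intro pos_sem_geI) linarith
    moreover have "pos_sem fin_aut w \<le> 1" by (rule pos_sem_leI) (simp add: LimAvg_fin_aut_le)
    ultimately show ?thesis using True by simp
  next
    case False
    have AE: "AE r in M. LimAvg (run_weights fin_aut w r) = 0"
      using AE_is_run by eventually_elim (rule LimAvg_fin_aut_infinite[OF w False])
    have "AE r in M. 0 \<le> LimAvg (run_weights fin_aut w r)" using AE by eventually_elim simp
    then have "0 \<le> pos_sem fin_aut w" by (intro pos_sem_geI) (simp add: AE_LimAvg_ge_iff[symmetric])
    moreover have "pos_sem fin_aut w \<le> 0" by (rule pos_sem_leI) (use AE in eventually_elim, simp)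
    ultimately show ?thesis using False by simp
  qed
qed

subsection \<open>Survival\<close>

definition survival :: "(nat \<Rightarrow> nat) \<Rightarrow> nat \<Rightarrow> nat \<Rightarrow> real" where
  "survival w q n = measure (run_measure survival_aut w) {r. r n = q}"

definition alive :: "(nat \<Rightarrow> nat) \<Rightarrow> nat \<Rightarrow> real" where
  "alive w n = survival w 0 n + survival w 1 n"

locale survival_word =
  fixes w :: "nat \<Rightarrow> nat"
  assumes binary: "is_word {0, 1} w"
begin

sublocale pwa_word "{0, 1}" survival_aut w
  by (intro pwa_wordI wf_survival_aut binary)

lemma survival_start: "survival w q 0 = (if q = 0 then 1 else 0)"
  unfolding survival_def prob_first_state by (simp add: survival_aut_def)

lemma survival_Suc:
  "survival w q' (Suc n) = (\<Sum>q\<in>{0, 1, 2}. survival w q n * pa_trans survival_aut q (w n) q')"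
proof -
  have "pa_states survival_aut = {0, 1, 2}" by (simp add: survival_aut_def)
  then show ?thesis unfolding survival_def using prob_state_Suc[of n q'] by simp
qed

lemma survival_step_raw:
  "w n = 0 \<Longrightarrow> survival w 0 (Suc n) = survival w 0 n / 2"
  "w n = 0 \<Longrightarrow> survival w 1 (Suc n) = survival w 0 n / 2 + survival w 1 n"
  "w n = 1 \<Longrightarrow> survival w 0 (Suc n) = survival w 1 n"
  "w n = 1 \<Longrightarrow> survival w 1 (Suc n) = 0"
  unfolding survival_Suc by (simp_all add: survival_aut_def)

text \<open>The simplifier turns the natural number 1 into \<open>Suc 0\<close>, so the rules are
  kept in both forms.\<close>

lemmas survival_step = survival_step_raw survival_step_raw[unfolded One_nat_def]

lemma survival_nonneg: "survival w q n \<ge> 0"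
  by (simp add: survival_def)

lemma alive_step: "w n = 0 \<Longrightarrow> alive w (Suc n) = alive w n"
  "w n = 1 \<Longrightarrow> alive w (Suc n) = alive w n - survival w 0 n"
  by (simp_all add: alive_def survival_step)

lemma alive_antimono: "m \<le> n \<Longrightarrow> alive w n \<le> alive w m"
proof (induction n rule: dec_induct)
  case (step n)
  then show ?case using alive_step[of n] binary_word[OF binary, of n] survival_nonneg[of 0 n] by auto
qed simp

lemma alive_nonneg: "alive w n \<ge> 0"
  by (simp add: alive_def survival_nonneg)

lemma alive_sets: "{r. \<forall>i\<le>n. r i \<noteq> 2} \<in> sets seq_space" "{r. \<forall>i. r i \<noteq> 2} \<in> sets seq_space"
proof -
  have "{r \<in> space seq_space. \<forall>i\<le>n. r i \<noteq> 2} \<in> sets seq_space"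
    "{r \<in> space seq_space. \<forall>i. r i \<noteq> 2} \<in> sets seq_space" by measurable
  then show "{r. \<forall>i\<le>n. r i \<noteq> 2} \<in> sets seq_space" "{r. \<forall>i. r i \<noteq> 2} \<in> sets seq_space" by simp_all
qed

lemma dead_stays: "is_run survival_aut w r \<Longrightarrow> r i = 2 \<Longrightarrow> i \<le> j \<Longrightarrow> r j = 2"
  by (rule absorbing_stays) (auto simp: survival_aut_def)

lemma prob_alive: "prob {r. \<forall>i\<le>n. r i \<noteq> 2} = alive w n"
proof -
  have "prob {r. \<forall>i\<le>n. r i \<noteq> 2} = prob ({r. r n = 0} \<union> {r. r n = 1})"
  proof (rule finite_measure_eq_AE)
    show "AE r in M. r \<in> {r. \<forall>i\<le>n. r i \<noteq> 2} \<longleftrightarrow> r \<in> {r. r n = 0} \<union> {r. r n = 1}"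
      using AE_is_run
    proof eventually_elim
      case (elim r)
      have "(\<forall>i\<le>n. r i \<noteq> 2) \<longleftrightarrow> r n \<noteq> 2" using dead_stays[OF elim] by blast
      moreover have "r n \<in> {0, 1, 2}" using run_states[OF elim, of n] by (simp add: survival_aut_def)
      ultimately show ?case by auto
    qed
  qed (use alive_sets in auto)
  also have "\<dots> = alive w n"
    unfolding alive_def survival_def by (rule finite_measure_Union) auto
  finally show ?thesis .
qed

lemma prob_alive_forever: "alive w \<longlonglongrightarrow> prob {r. \<forall>i. r i \<noteq> 2}"
proof -
  have "(\<lambda>n. prob {r. \<forall>i\<le>n. r i \<noteq> 2}) \<longlonglongrightarrow> prob (\<Inter>n. {r. \<forall>i\<le>n. r i \<noteq> 2})"
    by (intro finite_Lim_measure_decseq) (use alive_sets in \<open>auto simp: decseq_def\<close>)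
  moreover have "(\<Inter>n. {r :: nat \<Rightarrow> nat. \<forall>i\<le>n. r i \<noteq> 2}) = {r. \<forall>i. r i \<noteq> 2}" by blast
  ultimately show ?thesis by (simp add: prob_alive)
qed

lemma LimAvg_survival:
  assumes "is_run survival_aut w r"
  shows "LimAvg (run_weights survival_aut w r) = (if \<forall>i. r i \<noteq> 2 then 1 else 0)"
proof (cases "\<forall>i. r i \<noteq> 2")
  case True
  then have "LimAvg (run_weights survival_aut w r) = 1"
    by (intro LimAvg_eventually_const[of 0]) (auto simp: run_weights_def survival_aut_def)
  with True show ?thesis by simp
next
  case False
  then obtain i where "r i = 2" by blast
  then have "r j = 2" if "i \<le> j" for j using dead_stays[OF assms _ that] by simp
  then have "LimAvg (run_weights survival_aut w r) = 0"
    by (intro LimAvg_eventually_const[of i]) (simp add: run_weights_def survival_aut_def)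
  with False show ?thesis by auto
qed

lemma pos_sem_survival_ge:
  assumes "0 < c" "\<And>n. c \<le> alive w n"
  shows "1 \<le> pos_sem survival_aut w"
proof (rule pos_sem_geI)
  have "c \<le> prob {r. \<forall>i. r i \<noteq> 2}"
    using prob_alive_forever by (rule LIMSEQ_le_const) (use assms in auto)
  also have "\<dots> \<le> prob (runs_ge survival_aut w 1)"
  proof (rule finite_measure_mono_AE)
    show "AE r in M. r \<in> {r. \<forall>i. r i \<noteq> 2} \<longrightarrow> r \<in> runs_ge survival_aut w 1"
      using AE_is_run by eventually_elim (auto simp: runs_ge_def LimAvg_survival)
  qed (simp add: runs_ge_sets)
  finally show "0 < prob (runs_ge survival_aut w 1)" using assms(1) by simp
qed

lemma pos_sem_survival_le:
  assumes "\<And>e. 0 < e \<Longrightarrow> \<exists>n. alive w n < e"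
  shows "pos_sem survival_aut w \<le> 0"
proof (rule pos_sem_leI)
  have "alive w \<longlonglongrightarrow> 0"
  proof (rule LIMSEQ_I)
    fix e :: real assume "0 < e"
    with assms obtain N where "alive w N < e" by blast
    then show "\<exists>N. \<forall>n\<ge>N. norm (alive w n - 0) < e"
      using alive_antimono alive_nonneg by (intro exI[of _ N]) (auto intro: le_less_trans)
  qed
  with prob_alive_forever have "prob {r. \<forall>i. r i \<noteq> 2} = 0" by (rule LIMSEQ_unique)
  then have "AE r in M. r \<notin> {r. \<forall>i. r i \<noteq> 2}" using alive_sets by (subst (asm) prob_eq_0) auto
  with AE_is_run show "AE r in M. LimAvg (run_weights survival_aut w r) \<le> 0"
    by eventually_elim (auto simp: LimAvg_survival)
qed

text \<open>All live mass starts in state 0. Each letter 0 leaves half of it there, and the final 1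
  kills exactly that remainder, the fraction \<open>(1 / 2) ^ m\<close>.\<close>

lemma alive_block:
  assumes "survival w 1 t = 0" "\<And>i. i < m \<Longrightarrow> w (t + i) = 0" "w (t + m) = 1"
  shows "alive w (Suc (t + m)) = alive w t * (1 - (1 / 2) ^ m)" "survival w 1 (Suc (t + m)) = 0"
proof -
  have "survival w 0 (t + j) = alive w t * (1 / 2) ^ j \<and> alive w (t + j) = alive w t" if "j \<le> m" for j
    using that
  proof (induction j)
    case 0
    then show ?case using assms by (simp add: alive_def)
  next
    case (Suc j)
    then have "w (t + j) = 0" using assms(2)[of j] by simp
    with Suc show ?case by (simp add: survival_step alive_step)
  qed
  from this[of m] show "alive w (Suc (t + m)) = alive w t * (1 - (1 / 2) ^ m)"
    using alive_step(2)[OF assms(3)] by (simp add: algebra_simps)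
  show "survival w 1 (Suc (t + m)) = 0" by (simp add: survival_step assms(3))
qed

lemma alive_two_ones:
  assumes "w t = 1" "w (t + m) = 1" "m > 0"
  shows "alive w (Suc (t + m)) \<le> (1 - (1 / 2) ^ m) * alive w (Suc t)"
proof -
  define a where "a = alive w (Suc t)"
  have a: "a \<ge> 0" by (simp add: a_def alive_nonneg)
  have mono: "(1 - (1 / 2) ^ j) * a \<le> (1 - (1 / 2) ^ Suc j) * a" for j
    using a by (intro mult_right_mono) auto
  \<comment> \<open>Either an intermediate 1 has already caused the loss, or at least
    \<open>(1 / 2) ^ j\<close> of the initial mass is still in state 0.\<close>
  have claim: "alive w (Suc t + j) \<le> (1 - (1 / 2) ^ j) * a \<or> (1 / 2) ^ j * a \<le> survival w 0 (Suc t + j)" for j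
  proof (induction j)
    case 0
    then show ?case using assms(1) by (simp add: a_def alive_def survival_step)
  next
    case (Suc j)
    have le: "alive w (Suc t + Suc j) \<le> alive w (Suc t + j)" by (intro alive_antimono) simp
    have le_a: "alive w (Suc t + j) \<le> a" unfolding a_def by (intro alive_antimono) simp
    from Suc show ?case
    proof
      assume "alive w (Suc t + j) \<le> (1 - (1 / 2) ^ j) * a"
      with le mono[of j] show ?thesis by linarith
    next
      assume x: "(1 / 2) ^ j * a \<le> survival w 0 (Suc t + j)"
      from binary_word[OF binary, of "Suc t + j"] show ?thesis
      proof
        assume "w (Suc t + j) = 0"
        then show ?thesis using x by (simp add: survival_step)
      next
        assume "w (Suc t + j) = 1"
        then have "alive w (Suc t + Suc j) = alive w (Suc t + j) - survival w 0 (Suc t + j)"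
          by (simp add: alive_step)
        also have "\<dots> \<le> (1 - (1 / 2) ^ j) * a" using x le_a by (simp add: algebra_simps)
        finally show ?thesis using mono[of j] by linarith
      qed
    qed
  qed
  \<comment> \<open>Only \<open>m - 1\<close> letters lie strictly between the two ones; the
    exponent \<open>m\<close> in the statement is a weaker bound that suffices.\<close>
  obtain j where j: "m = Suc j" using assms(3) by (cases m) auto
  have "alive w (Suc t + m) \<le> (1 - (1 / 2) ^ j) * a"
    using claim[of j]
  proof
    assume "alive w (Suc t + j) \<le> (1 - (1 / 2) ^ j) * a"
    moreover have "alive w (Suc t + m) \<le> alive w (Suc t + j)" by (intro alive_antimono) (simp add: j)
    ultimately show ?thesis by simp
  next
    assume x: "(1 / 2) ^ j * a \<le> survival w 0 (Suc t + j)"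
    have le_a: "alive w (Suc t + j) \<le> a" unfolding a_def by (intro alive_antimono) simp
    have "alive w (Suc t + m) = alive w (Suc t + j) - survival w 0 (Suc t + j)"
      using assms(2) by (simp add: j alive_step)
    with x le_a show ?thesis by (simp add: algebra_simps)
  qed
  with mono[of j] show ?thesis by (simp add: a_def j)
qed

text \<open>The 1 at \<open>t\<close> recurs in every period, so each period multiplies the live
  mass by at most \<open>1 - (1 / 2) ^ m\<close>, the same factor below 1 every time.\<close>

lemma pos_sem_survival_periodic:
  assumes "m > 0" and per: "\<And>i. i \<ge> s \<Longrightarrow> w (i + m) = w i" and "t \<ge> s" "w t = 1"
  shows "pos_sem survival_aut w \<le> 0"
proof (rule pos_sem_survival_le)
  fix e :: real assume "0 < e"
  define q :: real where "q = 1 - (1 / 2) ^ m"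
  have q: "0 \<le> q" "q < 1" by (auto simp: q_def power_le_one)
  have ones: "w (t + j * m) = 1" for j
  proof (induction j)
    case (Suc j)
    then show ?case using per[of "t + j * m"] assms(3) by (simp add: algebra_simps)
  qed (simp add: assms)
  have bound: "alive w (Suc (t + j * m)) \<le> q ^ j * alive w (Suc t)" for j
  proof (induction j)
    case (Suc j)
    have "alive w (Suc (t + j * m + m)) \<le> q * alive w (Suc (t + j * m))"
      unfolding q_def using ones[of j] ones[of "Suc j"] assms(1)
      by (intro alive_two_ones) (auto simp: algebra_simps)
    also have "\<dots> \<le> q * (q ^ j * alive w (Suc t))" using q Suc by (intro mult_left_mono) auto
    finally show ?case by (simp add: algebra_simps)
  qed simp
  have "(\<lambda>j. q ^ j * alive w (Suc t)) \<longlonglongrightarrow> 0 * alive w (Suc t)"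
    using q by (intro tendsto_mult LIMSEQ_realpow_zero tendsto_const) auto
  then have "(\<lambda>j. q ^ j * alive w (Suc t)) \<longlonglongrightarrow> 0" by simp
  then have "\<forall>\<^sub>F j in sequentially. q ^ j * alive w (Suc t) < e"
    using \<open>0 < e\<close> by (rule order_tendstoD(2))
  then obtain j where "q ^ j * alive w (Suc t) < e" by (auto simp: eventually_sequentially)
  with bound[of j] show "\<exists>n. alive w n < e" by (intro exI) (rule le_less_trans)
qed

end

text \<open>The exponents start at 2: ones at positions 1 and 2 would be adjacent, and the second
  would kill every run.\<close>

definition sparse_word :: "nat \<Rightarrow> nat" where
  "sparse_word n = (if \<exists>k\<ge>2. n = 2 ^ k then 1 else 0)"

lemma is_word_sparse_word: "is_word {0, 1} sparse_word"
  by (simp add: is_word_def sparse_word_def)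

lemma sparse_word_between:
  assumes "2 ^ k < n" "n < 2 ^ Suc k"
  shows "sparse_word n = 0"
proof -
  have "n \<noteq> 2 ^ j" for j
    using assms by (metis less_Suc_eq_le not_le power_strict_increasing_iff one_less_numeral_iff semiring_norm(76))
  then show ?thesis by (simp add: sparse_word_def)
qed

lemma pos_sem_sparse_word: "1 \<le> pos_sem survival_aut sparse_word"
proof -
  interpret survival_word sparse_word by unfold_locales (rule is_word_sparse_word)
  let ?w = sparse_word
  have one: "?w (2 ^ k) = 1" if "k \<ge> 2" for k using that by (auto simp: sparse_word_def)
  \<comment> \<open>The slack \<open>(1 / 2) ^ k\<close> halves in each round and thus can pay
    \<open>(1 / 2) ^ Suc k\<close>. The actual loss is at most \<open>(1 / 2) ^ (2 ^ k - 1)\<close>,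
    since \<open>2 ^ k - 1\<close> zeros separate the two powers.\<close>
  have inv: "1 / 2 + (1 / 2) ^ k \<le> alive ?w (Suc (2 ^ k)) \<and> survival ?w 1 (Suc (2 ^ k)) = 0"
    if "k \<ge> 2" for k
    using that
  proof (induction k rule: dec_induct)
    case base
    have "?w i = 0" if "i < 4" for i
    proof -
      have "i \<noteq> 2 ^ k" if "k \<ge> 2" for k
        using power_increasing[OF that, of "2::nat"] \<open>i < 4\<close> by auto
      then show ?thesis by (auto simp: sparse_word_def)
    qed
    with alive_block[of 0 4] one[of 2] show ?case by (simp add: survival_start alive_def power_numeral_reduce)
  next
    case (step k)
    define m :: nat where "m = 2 ^ k - 1"
    have pw: "k + 2 \<le> 2 ^ k" using step(1)
    proof (induction k rule: dec_induct)
      case (step n)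
      then show ?case by simp
    qed simp
    have sum: "Suc (2 ^ k) + m = 2 ^ Suc k" by (simp add: m_def)
    have z: "?w (Suc (2 ^ k) + i) = 0" if "i < m" for i
      by (rule sparse_word_between[of k]) (use that sum in linarith)+
    have o: "?w (Suc (2 ^ k) + m) = 1" unfolding sum using step(1) by (intro one) simp
    note b = alive_block[OF _ z o]
    have "alive ?w (Suc (2 ^ Suc k)) = alive ?w (Suc (2 ^ k)) * (1 - (1 / 2) ^ m)"
      and s: "survival ?w 1 (Suc (2 ^ Suc k)) = 0"
      using b[unfolded sum] step by auto
    then have "alive ?w (Suc (2 ^ Suc k)) = alive ?w (Suc (2 ^ k)) - alive ?w (Suc (2 ^ k)) * (1 / 2) ^ m"
      by (simp add: algebra_simps)
    moreover have "alive ?w (Suc (2 ^ k)) * (1 / 2) ^ m \<le> 1 * (1 / 2) ^ m"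
      using alive_antimono[of 0 "Suc (2 ^ k)"] by (intro mult_right_mono) (auto simp: alive_def survival_start)
    moreover have "(1 / 2 :: real) ^ m \<le> (1 / 2) ^ Suc k"
      using pw by (intro power_decreasing) (auto simp: m_def)
    moreover have "1 / 2 + (1 / 2) ^ k \<le> alive ?w (Suc (2 ^ k))" using step by simp
    moreover have "(1 / 2 :: real) ^ Suc k = (1 / 2) ^ k / 2" by simp
    ultimately have "1 / 2 + (1 / 2) ^ Suc k \<le> alive ?w (Suc (2 ^ Suc k))" by linarith
    with s show ?case by simp
  qed
  have "1 / 2 \<le> alive ?w n" for n
  proof -
    have "n \<le> 2 ^ n" by (rule less_imp_le) (rule less_exp)
    also have "\<dots> \<le> 2 ^ (n + 2)" by (intro power_increasing) auto
    finally have "alive ?w (Suc (2 ^ (n + 2))) \<le> alive ?w n" by (intro alive_antimono) simp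
    moreover have "0 \<le> (1 / 2 :: real) ^ (n + 2)" by simp
    moreover have "1 / 2 + (1 / 2) ^ (n + 2) \<le> alive ?w (Suc (2 ^ (n + 2)))" using inv[of "n + 2"] by simp
    ultimately show ?thesis by linarith
  qed
  then show ?thesis by (intro pos_sem_survival_ge[of "1 / 2"]) auto
qed

subsection \<open>Nondeterministic automata and ultimately periodic words\<close>

text \<open>The first \<open>s\<close> entries followed by endless repetition of the next
  \<open>m\<close>. It is polymorphic because words, runs and weight sequences are looped
  alike.\<close>

definition loop_word :: "(nat \<Rightarrow> 'a) \<Rightarrow> nat \<Rightarrow> nat \<Rightarrow> nat \<Rightarrow> 'a" where
  "loop_word w s m i = (if i < s then w i else w (s + (i - s) mod m))"

lemma loop_word_periodic:
  assumes "s \<le> i"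
  shows "loop_word w s m (i + m) = loop_word w s m i"
proof -
  have "i + m - s = (i - s) + m" using assms by simp
  then have "(i + m - s) mod m = (i - s) mod m" by (simp only: mod_add_self2)
  with assms show ?thesis by (simp add: loop_word_def)
qed

lemma is_word_loop_word: "is_word \<Sigma> w \<Longrightarrow> is_word \<Sigma> (loop_word w s m)"
  by (simp add: is_word_def loop_word_def)

context pwa_word
begin

lemma loop_run:
  assumes r: "is_run A w r" and m: "m > 0" and loop: "r (s + m) = r s"
  shows "is_run A (loop_word w s m) (loop_word r s m)"
    "run_weights A (loop_word w s m) (loop_word r s m) = loop_word (run_weights A w r) s m"
proof -
  have suc: "loop_word r s m (Suc i) = r (Suc (s + (i - s) mod m))" if "s \<le> i" for i
  proof -
    have "Suc i - s = Suc (i - s)" using that by simp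
    \<comment> \<open>At the seam the index wraps back to \<open>s\<close>, where the run has the
      same state as at \<open>s + m\<close>.\<close>
    moreover have "Suc ((i - s) mod m) = m \<Longrightarrow> r s = r (Suc (s + (i - s) mod m))"
      using loop by (metis add_Suc_right)
    ultimately show ?thesis using that by (auto simp: loop_word_def mod_Suc)
  qed
  have suc': "loop_word r s m (Suc i) = r (Suc i)" if "i < s" for i
    using that by (cases "Suc i = s") (auto simp: loop_word_def)
  have init: "loop_word r s m 0 = r 0" by (simp add: loop_word_def)
  have step: "pa_trans A (r i) (w i) (r (Suc i)) > 0" for i using r by (simp add: is_run_def)
  have "pa_trans A (loop_word r s m i) (loop_word w s m i) (loop_word r s m (Suc i)) > 0" for i
  proof (cases "i < s")
    case True
    then show ?thesis using step[of i] by (simp add: suc') (simp add: loop_word_def)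
  next
    case False
    then show ?thesis using step[of "s + (i - s) mod m"] by (simp add: suc) (simp add: loop_word_def)
  qed
  then show "is_run A (loop_word w s m) (loop_word r s m)"
    using r by (simp add: is_run_def init)
  show "run_weights A (loop_word w s m) (loop_word r s m) = loop_word (run_weights A w r) s m"
  proof
    fix i
    show "run_weights A (loop_word w s m) (loop_word r s m) i = loop_word (run_weights A w r) s m i"
      by (cases "i < s") (simp_all add: run_weights_def suc suc' , simp_all add: loop_word_def run_weights_def)
  qed
qed

lemma nd_sem_loop_ge:
  assumes r: "is_run A w r" and m: "m > 0" and loop: "r (s + m) = r s"
    and c: "c * real m \<le> (\<Sum>i<m. run_weights A w r (s + i))"
  shows "c \<le> nd_sem A (loop_word w s m)"
proof -
  interpret L: pwa_word \<Sigma> A "loop_word w s m"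
    using finite_alphabet wf word by (simp add: pwa_word_def is_word_loop_word)
  note lr = loop_run[OF r m loop]
  have "c \<le> LimAvg (run_weights A (loop_word w s m) (loop_word r s m))"
    unfolding lr(2)
  proof (rule LimAvg_periodic_ge[of _ "wt_bound \<Sigma> A" m s])
    show "\<bar>loop_word (run_weights A w r) s m i\<bar> \<le> wt_bound \<Sigma> A" for i
      by (simp add: loop_word_def abs_run_weights_le[OF r])
    have "(\<Sum>i<m. loop_word (run_weights A w r) s m (s + i)) = (\<Sum>i<m. run_weights A w r (s + i))"
      by (intro sum.cong) (auto simp: loop_word_def)
    then show "c * real m \<le> (\<Sum>i<m. loop_word (run_weights A w r) s m (s + i))" using c by simp
  qed (use m in \<open>auto simp: loop_word_periodic\<close>)
  then show ?thesis by (rule L.nd_sem_geI[OF lr(1)])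
qed

text \<open>A state visited infinitely often closes arbitrarily long loops at one fixed position
  \<open>s\<close>, and dropping the prefix before \<open>s\<close> hardly changes the average of a
  long loop. Long loops are required so that the loop can contain a prescribed letter.\<close>

lemma nd_sem_ultimately_periodic:
  assumes c: "c < nd_sem A w"
  shows "\<exists>s. \<forall>N. \<exists>m\<ge>N. m > 0 \<and> c \<le> nd_sem A (loop_word w s m)"
proof -
  from nd_sem_greaterD[OF c] obtain r where r: "is_run A w r" and lim: "c < LimAvg (run_weights A w r)" by blast
  define v where "v = run_weights A w r"
  define W where "W = wt_bound \<Sigma> A"
  have v: "\<bar>v i\<bar> \<le> W" for i unfolding v_def W_def by (rule abs_run_weights_le[OF r])
  have W: "W \<ge> 0" unfolding W_def by (rule wt_bound_nonneg)
  \<comment> \<open>The gap \<open>d - c\<close> will pay for the dropped prefix.\<close>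
  obtain d where d: "c < d" "d < LimAvg v" using dense[OF lim] unfolding v_def by blast
  from LimAvg_gtD[of v W, OF v d(2)] obtain N0 where N0: "\<And>n. n \<ge> N0 \<Longrightarrow> d < avg v n"
    by (auto simp: eventually_sequentially)
  have "finite (r ` UNIV)" using run_states[OF r] by (intro finite_subset[OF _ finite_states]) auto
  from pigeonhole_infinite[OF infinite_UNIV_nat this] obtain s where inf: "infinite {i. r i = r s}" by auto
  show ?thesis
  proof (rule exI[of _ s], rule allI)
    fix N
    define B where "B = Suc (nat \<lceil>(W * real s + \<bar>c\<bar> * real s) / (d - c)\<rceil>)"
    obtain n where n: "n \<ge> s + N + 1 + N0 + B" "r n = r s"
      using inf unfolding infinite_nat_iff_unbounded_le by blast
    define m where "m = n - s"
    have m: "m > 0" "m \<ge> N" "s + m = n" using n by (auto simp: m_def)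
    have "(W * real s + \<bar>c\<bar> * real s) / (d - c) \<le> real n" using n(1) unfolding B_def by linarith
    then have "W * real s + \<bar>c\<bar> * real s \<le> (d - c) * real n" using d(1) by (simp add: field_simps)
    moreover have "d * real n \<le> (\<Sum>i<n. v i)" using N0[of n] n by (simp add: avg_def field_simps)
    moreover have "(\<Sum>i<n. v i) = (\<Sum>i<s. v i) + (\<Sum>i<m. v (s + i))"
      unfolding m(3)[symmetric] by (rule sum_lessThan_add)
    moreover have "(\<Sum>i<s. v i) \<le> W * real s" using abs_sum_le_bound[of v W s, OF v] by linarith
    moreover have "- c * real s \<le> \<bar>c\<bar> * real s" by (intro mult_right_mono) auto
    moreover have "real m = real n - real s" using m(3) by linarith
    then have "c * real m = c * real n - c * real s" by (simp add: right_diff_distrib)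
    ultimately have "c * real m \<le> (\<Sum>i<m. v (s + i))" by (simp add: algebra_simps)
    moreover have "r (s + m) = r s" using n m by simp
    ultimately have "c \<le> nd_sem A (loop_word w s m)"
      unfolding v_def by (intro nd_sem_loop_ge[OF r m(1)])
    with m show "\<exists>m\<ge>N. m > 0 \<and> c \<le> nd_sem A (loop_word w s m)" by blast
  qed
qed

end

lemma survival_not_nd:
  assumes A: "wf_pwa {0, 1} A"
    and eq: "\<And>w. is_word {0, 1} w \<Longrightarrow> pos_sem survival_aut w = nd_sem A w"
  shows False
proof -
  let ?w = sparse_word
  interpret pwa_word "{0, 1}" A ?w by (intro pwa_wordI A is_word_sparse_word)
  have "1 / 2 < nd_sem A ?w" using pos_sem_sparse_word eq[OF is_word_sparse_word] by simp
  from nd_sem_ultimately_periodic[OF this] obtain s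
    where s: "\<And>N. \<exists>m\<ge>N. m > 0 \<and> 1 / 2 \<le> nd_sem A (loop_word ?w s m)" by blast
  \<comment> \<open>A power of two beyond \<open>s\<close>; a loop longer than \<open>t\<close>
    contains the 1 at this position.\<close>
  define t :: nat where "t = 2 ^ (s + 2)"
  have "s < 2 ^ s" by (rule less_exp)
  also have "(2::nat) ^ s \<le> 2 ^ (s + 2)" by (intro power_increasing) auto
  finally have t: "s \<le> t" by (simp add: t_def)
  from s[of "Suc t"] obtain m where m: "m \<ge> Suc t" "m > 0" "1 / 2 \<le> nd_sem A (loop_word ?w s m)" by blast
  have word: "is_word {0, 1} (loop_word ?w s m)" by (intro is_word_loop_word is_word_sparse_word)
  interpret L: survival_word "loop_word ?w s m" by unfold_locales (rule word)
  have "\<exists>k\<ge>2. t = 2 ^ k" unfolding t_def by (rule exI[of _ "s + 2"]) simp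
  then have "?w t = 1" by (simp add: sparse_word_def)
  then have "loop_word ?w s m t = 1" using t m(1) by (simp add: loop_word_def)
  then have "pos_sem survival_aut (loop_word ?w s m) \<le> 0"
    by (intro L.pos_sem_survival_periodic[OF m(2) loop_word_periodic t])
  with m(3) eq[OF word] show False by simp
qed

text \<open>A cycle on zeros of positive weight could be looped into a word with finitely many ones
  and positive value. Hence on zeros a run gains at most \<open>W\<close> per state,
  \<open>K\<close> in all, and as this holds for all runs one periodic word is enough.\<close>

lemma inf_not_nd:
  assumes A: "wf_pwa {0, 1} A"
    and eq: "\<And>w. is_word {0, 1} w \<Longrightarrow> as_sem inf_aut w = nd_sem A w"
  shows False
proof -
  define W where "W = wt_bound {0, 1} A"
  define K where "K = real (card (pa_states A)) * W"
  have W: "W \<ge> 0" unfolding W_def by (rule wt_bound_nonneg)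
  then have K: "K \<ge> 0" by (simp add: K_def)
  \<comment> \<open>A period earns at most \<open>K + W\<close>, which is at most half of its
    length.\<close>
  define m where "m = Suc (nat \<lceil>2 * (K + W)\<rceil>)"
  have m: "m > 0" "2 * (K + W) \<le> real m" unfolding m_def by (simp, linarith)
  define w :: "nat \<Rightarrow> nat" where "w = (\<lambda>i. if Suc i mod m = 0 then 1 else 0)"
  have word: "is_word {0, 1} w" by (simp add: is_word_def w_def)
  interpret pwa_word "{0, 1}" A w by (intro pwa_wordI A word)
  \<comment> \<open>Induction on the number of states still available: the part up to the last visit
    of \<open>r s\<close> is a cycle of nonpositive weight, the next step costs at most
    \<open>W\<close>, and the rest avoids \<open>r s\<close>.\<close>
  have block: "(\<Sum>i\<in>{s..<n}. run_weights A w r i) \<le> real k * W"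
    if r: "is_run A w r" and "\<And>i. s \<le> i \<Longrightarrow> i < n \<Longrightarrow> w i = 0"
      and "\<And>i. s \<le> i \<Longrightarrow> i \<le> n \<Longrightarrow> r i \<in> T" and "finite T" and "card T \<le> k" for r s n k T
    using that(2-)
  proof (induction k arbitrary: s T)
    case 0
    then have "\<not> s \<le> n" by force
    then show ?case by simp
  next
    case (Suc k)
    show ?case
    proof (cases "s < n")
      case False
      then show ?thesis using W by simp
    next
      case True
      define J where "J = {j. s \<le> j \<and> j \<le> n \<and> r j = r s}"
      define j where "j = Max J"
      have "s \<in> J" using True by (simp add: J_def)
      then have J: "finite J" "J \<noteq> {}" by (auto simp: J_def intro: finite_subset[of _ "{..n}"])
      from Max_in[OF J] have j: "s \<le> j" "j \<le> n" "r j = r s" by (auto simp: J_def j_def)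
      have J_le: "i \<le> j" if "i \<in> J" for i unfolding j_def by (rule Max_ge[OF J(1) that])
      have later: "r i \<noteq> r s" if "j < i" "i \<le> n" for i
      proof
        assume "r i = r s"
        with that j(1) have "i \<in> J" by (simp add: J_def)
        with J_le that(1) show False by force
      qed
      have cycle: "(\<Sum>i\<in>{s..<j}. run_weights A w r i) \<le> 0"
      proof (cases "s = j")
        case False
        define d where "d = j - s"
        have d: "d > 0" "s + d = j" using False j(1) by (auto simp: d_def)
        let ?w = "loop_word w s d"
        have zero: "?w i = 0" if "s \<le> i" for i
          using that d j(2) mod_less_divisor[OF d(1), of "i - s"]
          by (auto simp: loop_word_def intro!: Suc.prems(1))
        have fin: "finite {i. ?w i = 1}"
        proof (rule finite_subset[of _ "{..<s}"])
          show "{i. ?w i = 1} \<subseteq> {..<s}" using zero by (force simp: not_le[symmetric])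
        qed simp
        have w': "is_word {0, 1} ?w" by (rule is_word_loop_word[OF word])
        define S where "S = (\<Sum>i<d. run_weights A w r (s + i))"
        have "S / real d \<le> nd_sem A ?w"
          by (rule nd_sem_loop_ge[OF r d(1)]) (use d j in \<open>auto simp: S_def\<close>)
        then have "S / real d \<le> 0"
          using as_sem_inf_aut[OF w'] fin eq[OF w'] by simp
        then have "S \<le> 0" using d(1) by (simp add: field_simps)
        moreover have "S = (\<Sum>i\<in>{s..<j}. run_weights A w r i)"
          unfolding S_def d(2)[symmetric] by (simp add: sum.shift_bounds_nat_ivl lessThan_atLeast0 sum.atLeastLessThan_shift_0[of _ s "s + d"])
        ultimately show ?thesis by simp
      qed simp
      show ?thesis
      proof (cases "j = n")
        case True
        have "0 \<le> real (Suc k) * W" using W by simp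
        with cycle True show ?thesis by simp
      next
        case False
        then have jn: "j < n" using j by simp
        have rs: "r s \<in> T" using Suc.prems(2)[of s] True by simp
        have "(\<Sum>i\<in>{Suc j..<n}. run_weights A w r i) \<le> real k * W"
        proof (rule Suc.IH[of "Suc j" "T - {r s}"])
          show "r i \<in> T - {r s}" if "Suc j \<le> i" "i \<le> n" for i
            using Suc.prems(2)[of i] later[of i] that j(1) by auto
          show "card (T - {r s}) \<le> k" using Suc.prems(3,4) rs by simp
        qed (use Suc.prems j(1) in auto)
        moreover have "run_weights A w r j \<le> W"
          using abs_run_weights_le[OF r, of j] by (simp add: W_def)
        moreover have "(\<Sum>i\<in>{s..<n}. run_weights A w r i) =
            (\<Sum>i\<in>{s..<j}. run_weights A w r i) + (run_weights A w r j + (\<Sum>i\<in>{Suc j..<n}. run_weights A w r i))"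
          using j jn by (simp add: sum.atLeastLessThan_concat sum.atLeast_Suc_lessThan[symmetric])
        ultimately show ?thesis using cycle by (simp add: algebra_simps)
      qed
    qed
  qed
  have "nd_sem A w \<le> 1 / 2"
  proof (rule nd_sem_leI)
    fix r assume r: "is_run A w r"
    let ?v = "run_weights A w r"
    have S: "(\<Sum>i<j * m. ?v i) \<le> real j * (K + W)" for j
    proof (induction j)
      case (Suc j)
      have zero: "w i = 0" if "j * m \<le> i" "i < j * m + (m - 1)" for i
      proof -
        have "Suc i = j * m + (Suc i - j * m)" "Suc i - j * m < m" "Suc i - j * m > 0" using that by auto
        then have "Suc i mod m = Suc i - j * m" by (metis mod_less mod_mult_self3)
        with \<open>Suc i - j * m > 0\<close> show ?thesis by (simp add: w_def)
      qed
      have "(\<Sum>i\<in>{j * m..<j * m + (m - 1)}. ?v i) \<le> K"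
        unfolding K_def by (rule block[OF r, of _ _ "pa_states A"]) (use zero run_states[OF r] in auto)
      moreover have "?v (j * m + (m - 1)) \<le> W"
        using abs_run_weights_le[OF r, of "j * m + (m - 1)"] by (simp add: W_def)
      moreover have "(\<Sum>i<Suc j * m. ?v i) =
          (\<Sum>i<j * m. ?v i) + ((\<Sum>i\<in>{j * m..<j * m + (m - 1)}. ?v i) + ?v (j * m + (m - 1)))"
      proof -
        have e: "Suc j * m = Suc (j * m + (m - 1))" using m(1) by simp
        show ?thesis unfolding e
          by (simp add: lessThan_atLeast0 sum.atLeastLessThan_concat)
      qed
      ultimately show ?case using Suc by (simp add: algebra_simps)
    qed simp
    show "LimAvg ?v \<le> 1 / 2"
    proof (rule LimAvg_le_frequently)
      show "\<bar>?v i\<bar> \<le> wt_bound {0, 1} A" for i by (rule abs_run_weights_le[OF r])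
      fix N
      let ?n = "Suc N * m"
      have n: "real ?n > 0" using m(1) by (simp only: of_nat_0_less_iff nat_0_less_mult_iff) simp
      have "(\<Sum>i<?n. ?v i) \<le> real (Suc N) * (K + W)" by (rule S)
      also have "\<dots> \<le> real (Suc N) * (real m / 2)" using m(2) by (intro mult_left_mono) auto
      also have "\<dots> = 1 / 2 * real ?n" by (simp add: algebra_simps)
      finally have "avg ?v ?n \<le> 1 / 2"
        using n unfolding avg_def by (simp only: pos_divide_le_eq)
      moreover have "N * 1 \<le> N * m" using m(1) by (intro mult_le_mono2) simp
      then have "?n \<ge> N" by (simp only: mult_Suc)
      ultimately show "\<exists>n\<ge>N. avg ?v n \<le> 1 / 2" by blast
    qed
  qed
  moreover have "infinite {i. w i = 1}"
    unfolding infinite_ones_iff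
  proof
    fix N
    have e: "Suc (N * m + (m - 1)) = Suc N * m" using m(1) by simp
    have "w (N * m + (m - 1)) = 1" unfolding w_def e by simp
    moreover have "N * 1 \<le> N * m" using m(1) by (intro mult_le_mono2) simp
    then have "N * m + (m - 1) \<ge> N" by linarith
    ultimately show "\<exists>i\<ge>N. w i = 1" by blast
  qed
  ultimately show False using as_sem_inf_aut[OF word] eq[OF word] by simp
qed

subsection \<open>Almost-sure block events\<close>

lemma avg_frequently_le:
  assumes "\<And>i. \<bar>v i\<bar> \<le> W" "LimAvg v < c"
  shows "\<exists>n\<ge>N. avg v n \<le> c"
proof (rule ccontr)
  assume "\<not> ?thesis"
  then have "\<And>n. n \<ge> N \<Longrightarrow> c \<le> avg v n" by force
  then have "c \<le> LimAvg v" by (intro LimAvg_geI[of v W, OF assms(1)]) (auto simp: eventually_sequentially)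
  with assms(2) show False by simp
qed

context prob_space
begin

text \<open>Continuity from below turns a time that depends on the run into a deterministic time
  that is sufficient with high probability.\<close>

lemma incseq_AE_prob_ge:
  assumes "\<And>n. G n \<in> events" "incseq G" "AE x in M. \<exists>n. x \<in> G n" "0 < e"
  shows "\<exists>N. \<forall>n\<ge>N. 1 - e \<le> prob (G n)"
proof -
  have "(\<lambda>n. prob (G n)) \<longlonglongrightarrow> prob (\<Union>n. G n)"
    by (intro finite_Lim_measure_incseq) (use assms in auto)
  moreover have "prob (\<Union>n. G n) = 1"
    using assms(1,3) by (subst prob_eq_1) auto
  ultimately have "\<forall>\<^sub>F n in sequentially. 1 - e < prob (G n)"
    using assms(4) by (intro order_tendstoD(1)) auto
  then show ?thesis by (auto simp: eventually_sequentially intro: less_imp_le)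
qed

lemma borel_cantelli_half:
  assumes E: "\<And>i. E i \<in> events" and p: "\<And>i. 1 - (1 / 2) ^ i \<le> prob (E i)"
  shows "AE x in M. \<forall>\<^sub>F i in sequentially. x \<in> E i"
proof -
  have "summable (\<lambda>i. prob (space M - E i))"
  proof (rule summable_comparison_test)
    show "summable (\<lambda>i. (1 / 2 :: real) ^ i)" by simp
    show "\<exists>N. \<forall>n\<ge>N. norm (prob (space M - E n)) \<le> (1 / 2) ^ n"
      using p E by (auto simp: prob_compl algebra_simps)
  qed
  then have "AE x in M. \<forall>\<^sub>F i in sequentially. x \<in> space M - (space M - E i)"
    by (intro borel_cantelli_AE1) (use E in \<open>auto simp: less_top[symmetric]\<close>)
  then show ?thesis by eventually_elim (auto elim: eventually_mono)
qed

end

lemma run_weights_cong: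
  "w i = w' i \<Longrightarrow> run_weights A w r i = run_weights A w' r i"
  by (simp add: run_weights_def)

lemma run_weights_cong_run:
  "r i = r' i \<Longrightarrow> r (Suc i) = r' (Suc i) \<Longrightarrow> run_weights A w r i = run_weights A w r' i"
  by (simp add: run_weights_def)

section \<open>Binary words as sets of positions\<close>

definition ones_at :: "nat set \<Rightarrow> nat \<Rightarrow> nat" where
  "ones_at V i = (if i \<in> V then 1 else 0)"

lemma is_word_ones_at: "is_word {0, 1} (ones_at V)"
  by (simp add: is_word_def ones_at_def)

lemma ones_of_ones_at: "{i. ones_at V i = 1} = V"
  by (auto simp: ones_at_def)

lemma as_sem_inf_aut_ones_at: "as_sem inf_aut (ones_at V) = (if infinite V then 1 else 0)"
  using as_sem_inf_aut[OF is_word_ones_at, of V] by (simp only: ones_of_ones_at)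

text \<open>After finitely many ones, reading zeros makes the average small at some time almost
  surely, and with high probability before a deterministic time, where the next one is placed.
  Different runs may meet the small average at different times.\<close>

lemma inf_not_pos:
  assumes A: "wf_pwa {0, 1} A"
    and eq: "\<And>w. is_word {0, 1} w \<Longrightarrow> as_sem inf_aut w = pos_sem A w"
  shows False
proof -
  have pwa: "pwa_word {0, 1} A (ones_at V)" for V by (intro pwa_wordI A is_word_ones_at)
  \<comment> \<open>The event involves only states up to \<open>T\<close> and letters before
    \<open>T\<close>, so it can be evaluated before the later ones are placed.\<close>
  define low where "low = (\<lambda>V i T. {r. \<exists>n\<in>{i..T}. avg (run_weights A (ones_at V) r) n \<le> 1 / 2})"
  have low_local: "low V i T = low V' i T" if "\<And>x. x < T \<Longrightarrow> ones_at V x = ones_at V' x" for V V' i T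
  proof -
    have "avg (run_weights A (ones_at V) r) n = avg (run_weights A (ones_at V') r) n" if "n \<le> T" for n r
      unfolding avg_def using that \<open>\<And>x. x < T \<Longrightarrow> ones_at V x = ones_at V' x\<close>
      by (intro arg_cong2[where f = "(/)"] sum.cong refl run_weights_cong) auto
    then show ?thesis unfolding low_def by (intro Collect_cong bex_cong refl) auto
  qed
  have low_prefix: "r' \<in> low V i T" if "\<forall>j\<le>T. r j = r' j" "r \<in> low V i T" for r r' V i T
  proof -
    have "avg (run_weights A (ones_at V) r) n = avg (run_weights A (ones_at V) r') n" if "n \<le> T" for n
      unfolding avg_def using that \<open>\<forall>j\<le>T. r j = r' j\<close>
      by (intro arg_cong2[where f = "(/)"] sum.cong refl run_weights_cong_run) auto
    with that(2) show ?thesis by (auto simp: low_def)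
  qed
  have low_sets: "low V i T \<in> sets seq_space" for V i T
    by (rule run_measure_local(2)[OF pwa pwa, of T V V]) (simp, blast intro: low_prefix)
  have "\<exists>T. T \<ge> i \<and> (\<forall>x\<in>V. x < T) \<and> 1 - (1 / 2) ^ i \<le> measure (run_measure A (ones_at V)) (low V i T)"
    if V: "finite V" for V i
  proof -
    interpret pwa_word "{0, 1}" A "ones_at V" by (rule pwa)
    have "pos_sem A (ones_at V) < 1 / 2"
      using as_sem_inf_aut_ones_at[of V] eq[OF is_word_ones_at[of V]] V by simp
    then have "AE r in M. LimAvg (run_weights A (ones_at V) r) < 1 / 2" by (rule pos_sem_lessD)
    with AE_is_run have "AE r in M. \<exists>T. r \<in> low V i T"
    proof eventually_elim
      case (elim r)
      from avg_frequently_le[of "run_weights A (ones_at V) r", OF abs_run_weights_le[OF elim(1)] elim(2)]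
      obtain n where "n \<ge> i" "avg (run_weights A (ones_at V) r) n \<le> 1 / 2" by blast
      then have "r \<in> low V i n" by (auto simp: low_def)
      then show ?case ..
    qed
    then have "\<exists>N. \<forall>T\<ge>N. 1 - (1 / 2) ^ i \<le> prob (low V i T)"
    proof (rule incseq_AE_prob_ge[rotated 2])
      show "low V i T \<in> events" for T by (simp add: low_sets)
      show "incseq (low V i)" by (force simp: incseq_def low_def)
    qed simp
    then obtain N where N: "\<And>T. T \<ge> N \<Longrightarrow> 1 - (1 / 2) ^ i \<le> prob (low V i T)" by blast
    \<comment> \<open>\<open>T\<close> also exceeds every element of \<open>V\<close>: the ones are
      placed at strictly increasing positions, and none falls before an earlier deadline.\<close>
    define T where "T = N + i + Suc (Max (insert 0 V))"
    have "x < T" if "x \<in> V" for x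
    proof -
      have "x \<le> Max (insert 0 V)" using that V by (intro Max_ge) auto
      then show ?thesis unfolding T_def by linarith
    qed
    with N[of T] show ?thesis by (intro exI[of _ T]) (auto simp: T_def)
  qed
  then obtain T where T: "\<And>V i. finite V \<Longrightarrow> T V i \<ge> i"
      "\<And>V i x. finite V \<Longrightarrow> x \<in> V \<Longrightarrow> x < T V i"
      "\<And>V i. finite V \<Longrightarrow> 1 - (1 / 2) ^ i \<le> measure (run_measure A (ones_at V)) (low V i (T V i))"
    by metis
  define V where "V = rec_nat {} (\<lambda>i V. insert (T V i) V)"
  have V_Suc: "V (Suc i) = insert (T (V i) i) (V i)" and V_0: "V 0 = {}" for i by (simp_all add: V_def)
  have fin: "finite (V i)" for i by (induction i) (simp_all add: V_0 V_Suc)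
  define t where "t = (\<lambda>i. T (V i) i)"
  have V_eq: "V i = t ` {..<i}" for i
    by (induction i) (simp_all add: V_0 V_Suc t_def lessThan_Suc)
  have t_mono: "t i < t j" if "i < j" for i j
  proof -
    have "t i \<in> V j" using that by (simp add: V_eq)
    then show ?thesis unfolding t_def by (intro T(2) fin) (simp add: t_def)
  qed
  define U where "U = range t"
  have "inj t" by (rule linorder_injI) (use t_mono in force)
  then have U_inf: "infinite U" unfolding U_def by (rule range_inj_infinite)
  interpret pwa_word "{0, 1}" A "ones_at U" by (rule pwa)
  have agree: "ones_at (V i) x = ones_at U x" if "x < t i" for x i
  proof -
    have "j < i" if "t j < t i" for j
      using t_mono[of i j] that by (metis not_less_iff_gr_or_eq)
    with that show ?thesis by (auto simp: ones_at_def V_eq U_def)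
  qed
  have "AE r in M. \<forall>\<^sub>F i in sequentially. r \<in> low U i (t i)"
  proof (rule borel_cantelli_half)
    show "low U i (t i) \<in> events" for i by (simp add: low_sets)
    fix i
    \<comment> \<open>Transfer from the final word to the finite set \<open>V i\<close>, where the
      probability is known: first the event, then the measure.\<close>
    have "low U i (t i) = low (V i) i (t i)" by (rule low_local) (simp add: agree)
    moreover have "measure (run_measure A (ones_at (V i))) (low (V i) i (t i)) = prob (low (V i) i (t i))"
      by (rule run_measure_local(1)[OF pwa pwa, of "t i"]) (simp add: agree, blast intro: low_prefix)
    ultimately show "1 - (1 / 2) ^ i \<le> prob (low U i (t i))"
      using T(3)[OF fin[of i], of i] by (simp add: t_def)
  qed
  with AE_is_run have "AE r in M. LimAvg (run_weights A (ones_at U) r) \<le> 1 / 2"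
  proof eventually_elim
    case (elim r)
    show ?case
    proof (rule LimAvg_le_frequently[OF abs_run_weights_le[OF elim(1)]])
      fix N
      \<comment> \<open>The window of round \<open>i\<close> starts at time \<open>i\<close>, which
        makes the small averages occur arbitrarily late.\<close>
      from elim(2) obtain i where i: "i \<ge> N" "r \<in> low U i (t i)"
        by (auto simp: eventually_sequentially) (metis le_cases)
      then obtain n where "n \<ge> i" "avg (run_weights A (ones_at U) r) n \<le> 1 / 2"
        by (auto simp: low_def)
      with i(1) show "\<exists>n\<ge>N. avg (run_weights A (ones_at U) r) n \<le> 1 / 2"
        using le_trans by blast
    qed
  qed
  then have "pos_sem A (ones_at U) \<le> 1 / 2" by (rule pos_sem_leI)
  then show False using as_sem_inf_aut_ones_at[of U] eq[OF is_word_ones_at[of U]] U_inf by simp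
qed

text \<open>The rate drops from 1/2 to 1/3 to get an eventual bound, and to 1/4 to absorb the first
  \<open>t\<close> terms: \<open>n / 3 - W * t\<close> is at least \<open>n / 4\<close> once
  \<open>n\<close> is at least \<open>12 * W * t\<close>.\<close>

lemma shifted_sum_ge:
  assumes v: "\<And>i. \<bar>v i\<bar> \<le> W" and lim: "1 / 2 \<le> LimAvg v"
  shows "\<exists>K. \<forall>n\<ge>K. real n / 4 \<le> (\<Sum>i<n. v (t + i))"
proof -
  have W: "W \<ge> 0" using v[of 0] by linarith
  have "1 / 3 < LimAvg v" using lim by linarith
  from LimAvg_gtD[of v W, OF v this] obtain N where N: "\<And>n. n \<ge> N \<Longrightarrow> 1 / 3 < avg v n"
    by (auto simp: eventually_sequentially)
  show ?thesis
  proof (intro exI allI impI)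
    fix n assume n: "Suc N + nat \<lceil>12 * (W * real t)\<rceil> \<le> n"
    then have "1 / 3 * real (t + n) \<le> (\<Sum>i<t + n. v i)"
      using N[of "t + n"] by (simp add: avg_def field_simps)
    then have "real n / 3 + real t / 3 \<le> (\<Sum>i<t. v i) + (\<Sum>i<n. v (t + i))"
      by (simp only: sum_lessThan_add) (simp add: field_simps)
    moreover have "(\<Sum>i<t. v i) \<le> W * real t" using abs_sum_le_bound[of v W t, OF v] by linarith
    moreover have "12 * (W * real t) \<le> real n" using n by linarith
    ultimately show "real n / 4 \<le> (\<Sum>i<n. v (t + i))" by linarith
  qed
qed

text \<open>Block \<open>i\<close> starts at \<open>t i\<close> and consists of \<open>k i\<close>
  zeros and a 1; \<open>K i\<close> is its warm-up, after which its averages are good.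
  \<open>k_large\<close> says precisely that a block of rate 1/4 with worst possible last letter
  exceeds the rate 1/8 by at least \<open>(W + 1) * K (Suc i)\<close>, the price of the next
  warm-up.\<close>

locale zero_blocks =
  fixes k K :: "nat \<Rightarrow> nat" and t :: "nat \<Rightarrow> nat" and W :: real
  assumes t_0: "t 0 = 0" and t_Suc: "\<And>i. t (Suc i) = t i + k i + 1"
    and W: "W \<ge> 0" and k_ge: "\<And>i. K i \<le> k i"
    and k_large: "\<And>i. 8 * W + 1 + 8 * (W + 1) * real (K (Suc i)) \<le> real (k i)"
begin

lemma t_mono: "i \<le> j \<Longrightarrow> t i \<le> t j"
  by (rule lift_Suc_mono_le[of t]) (auto simp: t_Suc)

lemma block_exists: "\<exists>i. t i \<le> n \<and> n < t (Suc i)"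
proof (induction n)
  case 0
  then show ?case by (intro exI[of _ 0]) (simp add: t_0 t_Suc)
next
  case (Suc n)
  then obtain i where i: "t i \<le> n" "n < t (Suc i)" by blast
  show ?case
  proof (cases "Suc n < t (Suc i)")
    case True
    with i show ?thesis by (intro exI[of _ i]) auto
  next
    case False
    with i show ?thesis by (intro exI[of _ "Suc i"]) (auto simp: t_Suc)
  qed
qed

definition word :: "nat \<Rightarrow> nat" where
  "word = ones_at (range (\<lambda>i. t i + k i))"

lemma word_block_zero:
  assumes "i < k j"
  shows "word (t j + i) = 0"
proof -
  have "t j + i \<noteq> t l + k l" for l
  proof (cases "l < j")
    case True
    then have "t (Suc l) \<le> t j" by (intro t_mono) simp
    then show ?thesis by (simp add: t_Suc)
  next
    case False
    then have "t j \<le> t l" by (intro t_mono) simp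
    moreover have "t (Suc j) \<le> t l" if "l \<noteq> j" using False that by (intro t_mono) simp
    ultimately show ?thesis using assms by (cases "l = j") (auto simp: t_Suc)
  qed
  then show ?thesis by (auto simp: word_def ones_at_def)
qed

lemma infinite_ones: "infinite {i. word i = 1}"
proof -
  have "inj (\<lambda>i. t i + k i)"
  proof (rule linorder_injI)
    fix i j :: nat assume "i < j"
    then have "t (Suc i) \<le> t j" by (intro t_mono) simp
    then show "t i + k i \<noteq> t j + k j" by (simp add: t_Suc)
  qed
  then show ?thesis unfolding word_def ones_of_ones_at by (rule range_inj_infinite)
qed

text \<open>Each good block increases the surplus \<open>D\<close> over the rate 1/8 by enough to
  cover the next warm-up, during which the weights may be as bad as \<open>- W\<close>.\<close>

lemma LimAvg_ge_good_blocks: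
  assumes v: "\<And>i. \<bar>v i\<bar> \<le> W"
    and good: "\<And>i n. i0 \<le> i \<Longrightarrow> K i \<le> n \<Longrightarrow> n \<le> k i \<Longrightarrow> real n / 4 \<le> (\<Sum>j<n. v (t i + j))"
  shows "1 / 8 \<le> LimAvg v"
proof (rule LimAvg_ge_linear[OF v])
  define S where "S = (\<lambda>n. \<Sum>i<n. v i)"
  have lower: "- (W * real n) \<le> (\<Sum>i<n. v (l + i))" for l n
    using abs_sum_le_bound[of "\<lambda>i. v (l + i)" W n, OF v] by linarith
  define D where "D = (\<lambda>i. S (t i) - real (t i) / 8)"
  have incr: "D i + (W + 1) * real (K (Suc i)) \<le> D (Suc i)"
    if "i0 \<le> i" for i
  proof -
    have "S (t (Suc i)) = S (t i) + (\<Sum>j<k i. v (t i + j)) + v (t i + k i)"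
      by (simp add: S_def t_Suc sum_lessThan_add)
    moreover have "real (k i) / 4 \<le> (\<Sum>j<k i. v (t i + j))" using that by (intro good k_ge) auto
    moreover have "- W \<le> v (t i + k i)" using v[of "t i + k i"] by linarith
    moreover have "real (t (Suc i)) = real (t i) + real (k i) + 1" by (simp add: t_Suc)
    moreover define x where "x = (W + 1) * real (K (Suc i))"
    have k: "8 * W + 1 + 8 * x \<le> real (k i)" using k_large[of i] unfolding x_def by (simp only: mult.assoc)
    ultimately show ?thesis unfolding x_def[symmetric] D_def by linarith
  qed
  \<comment> \<open>Only the gain of the latest block is used; the earlier gains are merely
    nonnegative.\<close>
  have start: "D i0 + (W + 1) * real (K i) \<le> D i" if "Suc i0 \<le> i" for i
    using that
  proof (induction i rule: dec_induct)
    case base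
    then show ?case using incr[of i0] by simp
  next
    case (step i)
    have "0 \<le> (W + 1) * real (K i)" using W by simp
    moreover have "D i + (W + 1) * real (K (Suc i)) \<le> D (Suc i)"
      using step(1) by (intro incr) simp
    ultimately show ?case using step.IH by linarith
  qed
  define C where "C = (W + 1) * real (t (Suc i0))"
  fix n
  show "1 / 8 * real n - C \<le> (\<Sum>i<n. v i)"
  proof (cases "n < t (Suc i0)")
    case True
    then have "(W + 1) * real n \<le> C" unfolding C_def using W by (intro mult_left_mono) auto
    moreover have "(W + 1) * real n = W * real n + real n" by (simp add: algebra_simps)
    ultimately show ?thesis using lower[of n 0] by simp
  next
    case False
    obtain i where i: "t i \<le> n" "n < t (Suc i)" using block_exists by blast
    have "Suc i0 \<le> i"
    proof (rule ccontr)
      assume "\<not> Suc i0 \<le> i"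
      then have "t (Suc i) \<le> t (Suc i0)" by (intro t_mono) simp
      with i False show False by simp
    qed
    define l where "l = n - t i"
    have n: "n = t i + l" "l \<le> k i" using i by (auto simp: l_def t_Suc)
    have "- (W * real (t i0)) \<le> S (t i0)" using lower[of "t i0" 0] by (simp add: S_def)
    moreover have "(W + 1) * real (t i0) \<le> C"
      unfolding C_def using W t_mono[of i0 "Suc i0"] by (intro mult_left_mono) auto
    moreover have "(W + 1) * real (t i0) = W * real (t i0) + real (t i0)" by (simp add: algebra_simps)
    moreover note start[OF \<open>Suc i0 \<le> i\<close>, unfolded D_def]
    \<comment> \<open>In the warm-up a letter costs at most \<open>W + 1\<close>; after it the rate
      1/4 beats 1/8.\<close>
    moreover have "real l / 8 - (W + 1) * real (K i) \<le> (\<Sum>j<l. v (t i + j))"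
    proof (cases "K i \<le> l")
      case True
      have "0 \<le> (W + 1) * real (K i)" using W by simp
      moreover have "real l / 4 \<le> (\<Sum>j<l. v (t i + j))" using \<open>Suc i0 \<le> i\<close> True n(2) by (intro good) auto
      ultimately show ?thesis by linarith
    next
      case False
      then have "(W + 1) * real l \<le> (W + 1) * real (K i)" using W by (intro mult_left_mono) auto
      moreover have "(W + 1) * real l = W * real l + real l" by (simp add: algebra_simps)
      ultimately show ?thesis using lower[of l "t i"] by linarith
    qed
    moreover have "(\<Sum>i<n. v i) = S (t i) + (\<Sum>j<l. v (t i + j))" by (simp add: n S_def sum_lessThan_add)
    moreover have "real n = real (t i) + real l" by (simp add: n)
    ultimately show ?thesis by linarith
  qed
qed

end

text \<open>Every reachable state has almost surely a large average on the word of zeros, hence with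
  high probability after a time that is uniform over the finitely many states. Blocks of zeros
  that are much longer than the time needed in the next block keep the limit average positive.\<close>

lemma fin_not_as:
  assumes A: "wf_pwa {0, 1} A"
    and eq: "\<And>w. is_word {0, 1} w \<Longrightarrow> as_sem A w = (if finite {i. w i = 1} then 1 else 0)"
  shows False
proof -
  let ?zero = "\<lambda>_::nat. 0::nat"
  have zero_word: "is_word {0, 1} ?zero" by (simp add: is_word_def)
  define W where "W = wt_bound {0, 1} A"
  define S where "S = pa_states A"
  define sum0 where "sum0 = (\<lambda>r n. \<Sum>j<n. run_weights A ?zero r j)"
  \<comment> \<open>The warm-up times are fixed before the block word exists, so reachability refers
    to all words and times.\<close>
  define reach where "reach q \<longleftrightarrow>
    (\<exists>v t. is_word {0, 1} v \<and> measure (run_measure A v) {r. r t = q} > 0)" for q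
  define G where "G = (\<lambda>K. {r. \<forall>n\<ge>K. real n / 4 \<le> sum0 r n})"
  interpret Z: pwa_word "{0, 1}" A ?zero by (intro pwa_wordI A zero_word)
  have finS: "finite S" by (simp add: S_def)
  have G_sets: "G K \<in> sets seq_space" for K
  proof -
    have "{r \<in> space seq_space. \<forall>n\<ge>K. real n / 4 \<le> sum0 r n} \<in> sets seq_space"
      unfolding sum0_def by measurable
    then show ?thesis by (simp add: G_def)
  qed
  have G_mono: "K \<le> K' \<Longrightarrow> G K \<subseteq> G K'" for K K' by (auto simp: G_def)
  have reach_good: "AE r in run_measure (start_at A q) ?zero. \<exists>K. r \<in> G K" if q: "q \<in> S" "reach q" for q
  proof -
    interpret Q: pwa_word "{0, 1}" "start_at A q" ?zero
      using q(1) zero_word by (intro Z.pwa_word_start_at) (simp_all add: S_def)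
    obtain v t where v: "is_word {0, 1} v" "measure (run_measure A v) {r. r t = q} > 0"
      using q(2) by (auto simp: reach_def)
    \<comment> \<open>Follow \<open>v\<close> until \<open>q\<close> may be reached, then read
      zeros: finitely many ones, hence value 1. Since \<open>q\<close> has positive probability at
      time \<open>t\<close>, the Markov property passes the almost sure bound on to the runs started
      in \<open>q\<close>.\<close>
    define v' where "v' = (\<lambda>i. if i < t then v i else 0)"
    have v': "is_word {0, 1} v'" using v(1) by (auto simp: v'_def is_word_def)
    interpret V: pwa_word "{0, 1}" A v' by (intro pwa_wordI A v')
    have "V.prob {r. r t = q} = measure (run_measure A v) {r. r t = q}"
      by (rule run_measure_local(1)[OF V.pwa_word_axioms pwa_wordI[OF A v(1)], of t]) (auto simp: v'_def)
    with v(2) have pos: "V.prob {r. r t = q} > 0" by simp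
    have "finite {i. v' i = 1}" by (rule finite_subset[of _ "{..<t}"]) (auto simp: v'_def split: if_splits)
    then have "1 / 2 < as_sem A v'" using eq[OF v'] by simp
    from V.as_sem_greaterD[OF this] have lim: "AE r in V.M. 1 / 2 \<le> LimAvg (run_weights A v' r)" .
    define E where "E = UNIV - (\<Union>K. G K)"
    have E: "E \<in> sets seq_space" unfolding E_def by (intro sets.Diff sets.countable_UN) (auto simp: G_sets)
    have "AE r in V.M. r \<notin> {r. r t = q \<and> (\<lambda>i. r (t + i)) \<in> E}"
      using V.AE_is_run lim
    proof eventually_elim
      case (elim r)
      from shifted_sum_ge[OF V.abs_run_weights_le[OF elim(1)] elim(2), of t]
      obtain K where K: "\<And>n. n \<ge> K \<Longrightarrow> real n / 4 \<le> (\<Sum>i<n. run_weights A v' r (t + i))" by blast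
      have "run_weights A v' r (t + i) = run_weights A ?zero (\<lambda>i. r (t + i)) i" for i
        by (simp add: run_weights_def v'_def)
      with K have "(\<lambda>i. r (t + i)) \<in> G K" by (simp add: G_def sum0_def)
      then show ?case by (auto simp: E_def)
    qed
    moreover have ms: "{r. r t = q \<and> (\<lambda>i. r (t + i)) \<in> E} \<in> sets seq_space"
    proof -
      have "{r \<in> space seq_space. r t = q \<and> (\<lambda>i. r (t + i)) \<in> E} \<in> sets seq_space"
        using E V.measurable_shift by measurable
      then show ?thesis by simp
    qed
    ultimately have "V.prob {r. r t = q \<and> (\<lambda>i. r (t + i)) \<in> E} = 0"
      by (subst V.prob_eq_0) auto
    moreover have "(\<lambda>i. v' (t + i)) = ?zero" by (auto simp: v'_def)
    ultimately have "Q.prob E = 0"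
      using V.markov_property[OF q(1)[unfolded S_def] E, of t] pos by simp
    then have "AE r in Q.M. r \<notin> E" using E by (subst (asm) Q.prob_eq_0) auto
    then show ?thesis by eventually_elim (auto simp: E_def)
  qed
  have "\<exists>K. \<forall>q\<in>S. reach q \<longrightarrow> 1 - (1 / 2) ^ i \<le> measure (run_measure (start_at A q) ?zero) (G K)" for i
  proof -
    have "\<exists>N. \<forall>n\<ge>N. reach q \<longrightarrow> 1 - (1 / 2) ^ i \<le> measure (run_measure (start_at A q) ?zero) (G n)"
      if q: "q \<in> S" for q
    proof (cases "reach q")
      case True
      interpret Q: pwa_word "{0, 1}" "start_at A q" ?zero
        using q zero_word by (intro Z.pwa_word_start_at) (simp_all add: S_def)
      have "\<exists>N. \<forall>n\<ge>N. 1 - (1 / 2) ^ i \<le> Q.prob (G n)"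
        by (rule Q.incseq_AE_prob_ge[OF _ _ reach_good[OF q True]])
          (use G_mono in \<open>auto simp: G_sets incseq_def\<close>)
      then show ?thesis by blast
    qed simp
    then obtain N where N: "\<And>q n. q \<in> S \<Longrightarrow> n \<ge> N q \<Longrightarrow> reach q \<Longrightarrow>
        1 - (1 / 2) ^ i \<le> measure (run_measure (start_at A q) ?zero) (G n)" by metis
    have "N q \<le> Max (insert 0 (N ` S))" if "q \<in> S" for q using finS that by (intro Max_ge) auto
    with N show ?thesis by blast
  qed
  then obtain K where K: "\<And>i q. q \<in> S \<Longrightarrow> reach q \<Longrightarrow>
      1 - (1 / 2) ^ i \<le> measure (run_measure (start_at A q) ?zero) (G (K i))" by metis
  define k where "k = (\<lambda>i. K i + nat \<lceil>8 * W + 1 + 8 * (W + 1) * real (K (Suc i))\<rceil>)"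
  define t where "t = rec_nat 0 (\<lambda>i x. x + k i + 1)"
  interpret B: zero_blocks k K t W
  proof
    show "8 * W + 1 + 8 * (W + 1) * real (K (Suc i)) \<le> real (k i)" for i
      unfolding k_def by linarith
  qed (simp_all add: t_def k_def W_def wt_bound_nonneg)
  have word: "is_word {0, 1} B.word" unfolding B.word_def by (rule is_word_ones_at)
  interpret pwa_word "{0, 1}" A B.word by (intro pwa_wordI A word)
  \<comment> \<open>All lengths from \<open>K i\<close> to \<open>k i\<close> are required, not just
    the full block, because the liminf also sees partial blocks.\<close>
  define H where "H = (\<lambda>i. {r. \<forall>n. K i \<le> n \<and> n \<le> k i \<longrightarrow>
    real n / 4 \<le> (\<Sum>j<n. run_weights A B.word r (t i + j))})"
  have "AE r in M. \<forall>\<^sub>F i in sequentially. r \<in> H i"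
  proof (rule borel_cantelli_half)
    fix i
    define bad where "bad = {r. \<exists>n. K i \<le> n \<and> n \<le> k i \<and> sum0 r n < real n / 4}"
    have H_iff: "r \<notin> H i \<longleftrightarrow> (\<lambda>j. r (t i + j)) \<in> bad" for r
    proof -
      have "(\<Sum>j<n. run_weights A B.word r (t i + j)) = sum0 (\<lambda>j. r (t i + j)) n" if "n \<le> k i" for n
        unfolding sum0_def using that by (intro sum.cong refl) (simp add: run_weights_def B.word_block_zero)
      then show ?thesis unfolding H_def bad_def by (auto simp: not_le)
    qed
    have "H i \<in> sets seq_space"
    proof -
      have "{r \<in> space seq_space. \<forall>n. K i \<le> n \<and> n \<le> k i \<longrightarrow>
          real n / 4 \<le> (\<Sum>j<n. run_weights A B.word r (t i + j))} \<in> sets seq_space" by measurable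
      then show ?thesis by (simp add: H_def)
    qed
    then show H: "H i \<in> events" by simp
    have bad_prefix: "r' \<in> bad" if "\<forall>j\<le>k i. r j = r' j" "r \<in> bad" for r r'
    proof -
      have "sum0 r n = sum0 r' n" if "n \<le> k i" for n
        unfolding sum0_def using that \<open>\<forall>j\<le>k i. r j = r' j\<close>
        by (intro sum.cong refl run_weights_cong_run) auto
      with that(2) show ?thesis by (auto simp: bad_def)
    qed
    \<comment> \<open>A state that is not reachable has no mass. From a reachable one the block
      consists of zeros, and \<open>bad\<close> is disjoint from \<open>G (K i)\<close>.\<close>
    have bad_le: "prob {r. r (t i) = q \<and> (\<lambda>j. r (t i + j)) \<in> bad} \<le> prob {r. r (t i) = q} * (1 / 2) ^ i"
      if q: "q \<in> S" for q
    proof (cases "reach q")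
      case False
      then have "\<not> prob {r. r (t i) = q} > 0" using word unfolding reach_def by blast
      then have "prob {r. r (t i) = q} \<le> 0" by simp
      moreover have "prob {r. r (t i) = q \<and> (\<lambda>j. r (t i + j)) \<in> bad} \<le> prob {r. r (t i) = q}"
        by (intro finite_measure_mono) auto
      ultimately show ?thesis by (simp add: measure_le_0_iff)
    next
      case True
      let ?u = "\<lambda>j. B.word (t i + j)"
      have u: "is_word {0, 1} ?u" using word by (simp add: is_word_def)
      have q': "q \<in> pa_states A" using q by (simp add: S_def)
      interpret Q: pwa_word "{0, 1}" "start_at A q" ?zero by (rule pwa_word_start_at[OF q' zero_word])
      note local = run_measure_local[OF pwa_word_start_at[OF q' u] Q.pwa_word_axioms, of "k i" bad]
      have bad_sets: "bad \<in> sets seq_space" by (rule local(2)) (simp add: B.word_block_zero, blast intro: bad_prefix)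
      have "measure (run_measure (start_at A q) ?u) bad = Q.prob bad"
        by (rule local(1)) (simp add: B.word_block_zero, blast intro: bad_prefix)
      also have "\<dots> \<le> Q.prob (space Q.M - G (K i))"
        using G_sets bad_sets by (intro Q.finite_measure_mono sets.compl_sets) (auto simp: bad_def G_def)
      also have "\<dots> = 1 - Q.prob (G (K i))" by (rule Q.prob_compl) (simp add: G_sets)
      also have "\<dots> \<le> (1 / 2) ^ i" using K[OF q True, of i] by simp
      finally have "measure (run_measure (start_at A q) ?u) bad \<le> (1 / 2) ^ i" .
      then show ?thesis
        unfolding markov_property[OF q' bad_sets] by (intro mult_left_mono) auto
    qed
    have "1 - prob (H i) = prob (space M - H i)" by (rule prob_compl[OF H, symmetric])
    also have "\<dots> = (\<Sum>q\<in>S. prob {r. r (t i) = q \<and> r \<in> space M - H i})"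
      unfolding S_def using H by (intro prob_state_partition) (metis sets.compl_sets sets_M)
    also have "\<dots> = (\<Sum>q\<in>S. prob {r. r (t i) = q \<and> (\<lambda>j. r (t i + j)) \<in> bad})"
      by (simp add: H_iff)
    also have "\<dots> \<le> (\<Sum>q\<in>S. prob {r. r (t i) = q} * (1 / 2) ^ i)" by (intro sum_mono bad_le)
    also have "\<dots> = (\<Sum>q\<in>S. prob {r. r (t i) = q}) * (1 / 2) ^ i" by (simp only: sum_distrib_right)
    also have "(\<Sum>q\<in>S. prob {r. r (t i) = q}) = prob UNIV"
      using prob_state_partition[of UNIV "t i"] by (simp add: S_def)
    also have "prob UNIV = 1" using prob_space by simp
    finally show "1 - (1 / 2) ^ i \<le> prob (H i)" by simp
  qed
  with AE_is_run have "AE r in M. 1 / 8 \<le> LimAvg (run_weights A B.word r)"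
  proof eventually_elim
    case (elim r)
    from elim(2) obtain i0 where "\<And>i. i \<ge> i0 \<Longrightarrow> r \<in> H i" by (auto simp: eventually_sequentially)
    then show ?case
      using abs_run_weights_le[OF elim(1)]
      by (intro B.LimAvg_ge_good_blocks[of _ i0]) (auto simp: H_def W_def)
  qed
  then have "1 / 8 \<le> as_sem A B.word" by (rule as_sem_geI)
  then show False using eq[OF word] B.infinite_ones by simp
qed

section \<open>The five separations\<close>

theorem theorem2:
  shows "\<not> reducible as_sem pos_sem \<and> \<not> reducible pos_sem as_sem \<and>
         \<not> reducible as_sem nd_sem \<and> \<not> reducible nd_sem as_sem \<and>
         \<not> reducible pos_sem nd_sem"
proof -
  have not_reducible_by: "\<not> reducible sem1 sem2"
    if "wf_pwa {0, 1} A"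
      and "\<And>A'. wf_pwa {0, 1} A' \<Longrightarrow> (\<And>w. is_word {0, 1} w \<Longrightarrow> sem1 A w = sem2 A' w) \<Longrightarrow> False"
    for sem1 sem2 A
  proof
    assume red: "reducible sem1 sem2"
    have "finite {0, 1 :: nat} \<and> wf_pwa {0, 1} A" using that(1) by simp
    from red[unfolded reducible_def, THEN spec, THEN spec, THEN mp, OF this]
    obtain A' where "wf_pwa {0, 1} A'" "\<forall>w. is_word {0, 1} w \<longrightarrow> sem1 A w = sem2 A' w" by blast
    then show False by (intro that(2)) auto
  qed
  have "\<not> reducible as_sem pos_sem"
  proof (rule not_reducible_by[OF wf_inf_aut])
    fix A' assume "wf_pwa {0, 1} A'" "\<And>w. is_word {0, 1} w \<Longrightarrow> as_sem inf_aut w = pos_sem A' w"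
    then show False by (rule inf_not_pos)
  qed
  moreover have "\<not> reducible pos_sem as_sem"
  proof (rule not_reducible_by[OF wf_fin_aut])
    fix A' assume A': "wf_pwa {0, 1} A'" "\<And>w. is_word {0, 1} w \<Longrightarrow> pos_sem fin_aut w = as_sem A' w"
    \<comment> \<open>\<open>fin_not_as\<close> assumes a value formula rather than an equality of
      two semantics, so it applies to \<open>fin_aut\<close> under both \<open>pos_sem\<close> and
      \<open>nd_sem\<close>.\<close>
    show False by (rule fin_not_as[OF A'(1)]) (simp only: A'(2)[symmetric] pos_sem_fin_aut)
  qed
  moreover have "\<not> reducible as_sem nd_sem"
  proof (rule not_reducible_by[OF wf_inf_aut])
    fix A' assume "wf_pwa {0, 1} A'" "\<And>w. is_word {0, 1} w \<Longrightarrow> as_sem inf_aut w = nd_sem A' w"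
    then show False by (rule inf_not_nd)
  qed
  moreover have "\<not> reducible nd_sem as_sem"
  proof (rule not_reducible_by[OF wf_fin_aut])
    fix A' assume A': "wf_pwa {0, 1} A'" "\<And>w. is_word {0, 1} w \<Longrightarrow> nd_sem fin_aut w = as_sem A' w"
    show False by (rule fin_not_as[OF A'(1)]) (simp only: A'(2)[symmetric] nd_sem_fin_aut)
  qed
  moreover have "\<not> reducible pos_sem nd_sem"
  proof (rule not_reducible_by[OF wf_survival_aut])
    fix A' assume "wf_pwa {0, 1} A'" "\<And>w. is_word {0, 1} w \<Longrightarrow> pos_sem survival_aut w = nd_sem A' w"
    then show False by (rule survival_not_nd)
  qed
  ultimately show ?thesis by blast
qed

end
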